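(* Let $\Omega$ be a finite set with $n$ elements, let $G\leq\mathrm{Sym}(\Omega)$ be a transitive group given by a set $S$ of generators, and let $L$ be a positive integer. Suppose we are given a certified nonredundant partial base $\beta_1,\ldots,\beta_{L+1}$ for $G$ of size $L+1$, together with its certificate $g_1,\ldots,g_{L+1}$. If $L$ is an upper bound on the size of a nonredundant base for the action of $G$ on some block system, then from the certificate we can find a block system for $G$ in time $O(n|S|L\log n)$.
   Context: All logarithms are base two. Algorithms are deterministic and running times are worst-case, with an absolute implied constant in $O(\cdot)$; permutations of $\Omega$ are given explicitly, so that a product or inverse of permutations is computed in time $O(n)$ and the image of a single point under a stored permutation in time $O(1)$. A block system for the transitive group $G$ is a $G$-invariant partition of $\Omega$ other than the partition into singletons and the partition with a single cell. The action of $G$ on a block system is the permutation group induced by $G$ on the set of blocks. A base of a permutation group is a list of points whose pointwise stabilizer is trivial. A list $(\beta_1,\ldots,\beta_\ell)$ satisfies the nonredundancy condition if for each $i=1,\ldots,\ell$ there is $g_i\in G$ which fixes all $\beta_j$ with $j<i$ but does not fix $\beta_i$; a nonredundant base is a base satisfying this condition, and a nonredundant partial base is a prefix of a nonredundant base (equivalently, a list satisfying the nonredundancy condition). A nonredundant partial base given together with such elements $g_1,\ldots,g_\ell$ is called certified, and the list of the $g_i$ is its certificate. *)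

theory Defs
  imports "HOL-Algebra.Group_Action" "HOL-Algebra.Generated_Groups" "HOL-Library.Disjoint_Sets" Complex_Main
begin

section \<open>Permutation groups, block systems and bases\<close>

text \<open>A permutation group on \<open>\<Omega>\<close> is a set of elements of \<open>Bij \<Omega>\<close>; as there, a permutation is
  an extensional function.\<close>

abbreviation transitive_on :: "'a set \<Rightarrow> ('a \<Rightarrow> 'a) set \<Rightarrow> bool" where
  "transitive_on \<Omega> G \<equiv> transitive_action ((BijGroup \<Omega>)\<lparr>carrier := G\<rparr>) \<Omega> (\<lambda>g. g)"

definition block_system :: "'a set \<Rightarrow> ('a \<Rightarrow> 'a) set \<Rightarrow> 'a set set \<Rightarrow> bool" where
  "block_system \<Omega> G \<Sigma> \<longleftrightarrow>
     partition_on \<Omega> \<Sigma> \<and> (\<forall>g\<in>G. \<forall>B\<in>\<Sigma>. g ` B \<in> \<Sigma>) \<and> \<Sigma> \<noteq> (\<lambda>x. {x}) ` \<Omega> \<and> \<Sigma> \<noteq> {\<Omega>}"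

definition block_action :: "('a \<Rightarrow> 'a) set \<Rightarrow> 'a set set \<Rightarrow> ('a set \<Rightarrow> 'a set) set" where
  "block_action G \<Sigma> = (\<lambda>g. \<lambda>B\<in>\<Sigma>. g ` B) ` G"

definition is_base :: "'a set \<Rightarrow> ('a \<Rightarrow> 'a) set \<Rightarrow> 'a list \<Rightarrow> bool" where
  "is_base \<Omega> G bs \<longleftrightarrow> set bs \<subseteq> \<Omega> \<and> {g \<in> G. \<forall>b\<in>set bs. g b = b} = {\<one>\<^bsub>BijGroup \<Omega>\<^esub>}"

definition certifies :: "('a \<Rightarrow> 'a) set \<Rightarrow> 'a list \<Rightarrow> ('a \<Rightarrow> 'a) list \<Rightarrow> bool" where
  "certifies G bs gs \<longleftrightarrow> length gs = length bs \<and>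
     (\<forall>i<length bs. gs ! i \<in> G \<and> (\<forall>j<i. (gs ! i) (bs ! j) = bs ! j) \<and> (gs ! i) (bs ! i) \<noteq> bs ! i)"

definition nonredundant :: "('a \<Rightarrow> 'a) set \<Rightarrow> 'a list \<Rightarrow> bool" where
  "nonredundant G bs \<longleftrightarrow>
     (\<forall>i<length bs. \<exists>g\<in>G. (\<forall>j<i. g (bs ! j) = bs ! j) \<and> g (bs ! i) \<noteq> bs ! i)"

definition nonredundant_base :: "'a set \<Rightarrow> ('a \<Rightarrow> 'a) set \<Rightarrow> 'a list \<Rightarrow> bool" where
  "nonredundant_base \<Omega> G bs \<longleftrightarrow> is_base \<Omega> G bs \<and> nonredundant G bs"

definition certified_partial_base ::
    "'a set \<Rightarrow> ('a \<Rightarrow> 'a) set \<Rightarrow> 'a list \<Rightarrow> ('a \<Rightarrow> 'a) list \<Rightarrow> bool" where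
  "certified_partial_base \<Omega> G bs gs \<longleftrightarrow> set bs \<subseteq> \<Omega> \<and> certifies G bs gs"


section \<open>The machine model\<close>

text \<open>Algorithms are finite programs for a random access machine with finitely many named
  registers and finitely many named tables of words. A table is addressed by row and column, so
  that a stored permutation is a row of a table and the image of a point is one table access.
  The only arithmetic is increment and decrement. Hence one step raises the largest stored
  word by at most a constant depending on the program, and after polynomially many steps every
  word still has logarithmic length: charging one unit per step hides no arithmetic on long
  numbers.\<close>

record state =
  regs :: "string \<Rightarrow> nat"
  tabs :: "string \<Rightarrow> nat \<Rightarrow> nat \<Rightarrow> nat"

datatype expr =
    Const nat
  | Reg string
  | Read string expr expr
  | Inc expr
  | Dec expr

fun expr_val :: "expr \<Rightarrow> state \<Rightarrow> nat" where
  "expr_val (Const k) s = k"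
| "expr_val (Reg x) s = regs s x"
| "expr_val (Read a e f) s = tabs s a (expr_val e s) (expr_val f s)"
| "expr_val (Inc e) s = expr_val e s + 1"
| "expr_val (Dec e) s = expr_val e s - 1"

datatype test =
    Equal expr expr
  | Less expr expr
  | Neg test
  | Conj test test

fun test_val :: "test \<Rightarrow> state \<Rightarrow> bool" where
  "test_val (Equal e f) s \<longleftrightarrow> expr_val e s = expr_val f s"
| "test_val (Less e f) s \<longleftrightarrow> expr_val e s < expr_val f s"
| "test_val (Neg b) s \<longleftrightarrow> \<not> test_val b s"
| "test_val (Conj b c) s \<longleftrightarrow> test_val b s \<and> test_val c s"

datatype prog =
    Skip
  | Assign string expr
  | Write string expr expr expr
  | Seq prog prog
  | If test prog prog
  | While test prog

definition set_reg :: "string \<Rightarrow> nat \<Rightarrow> state \<Rightarrow> state" where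
  "set_reg x v s = s\<lparr>regs := (regs s)(x := v)\<rparr>"

definition set_tab :: "string \<Rightarrow> nat \<Rightarrow> nat \<Rightarrow> nat \<Rightarrow> state \<Rightarrow> state" where
  "set_tab a i j v s = s\<lparr>tabs := (tabs s)(a := (tabs s a)(i := (tabs s a i)(j := v)))\<rparr>"

text \<open>\<open>exec P s t s'\<close>: started in \<open>s\<close>, the program \<open>P\<close> halts in \<open>s'\<close> after \<open>t\<close> steps. Every
  assignment and every evaluation of a test is a step; the expressions in it are part of the
  program text, so their evaluation takes a constant number of elementary operations.\<close>

inductive exec :: "prog \<Rightarrow> state \<Rightarrow> nat \<Rightarrow> state \<Rightarrow> bool" where
  skip: "exec Skip s 1 s"
| assign: "exec (Assign x e) s 1 (set_reg x (expr_val e s) s)"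
| store: "exec (Write a e f g) s 1 (set_tab a (expr_val e s) (expr_val f s) (expr_val g s) s)"
| seq: "exec P s t s' \<Longrightarrow> exec Q s' u s'' \<Longrightarrow> exec (Seq P Q) s (t + u) s''"
| if_true: "test_val b s \<Longrightarrow> exec P s t s' \<Longrightarrow> exec (If b P Q) s (Suc t) s'"
| if_false: "\<not> test_val b s \<Longrightarrow> exec Q s t s' \<Longrightarrow> exec (If b P Q) s (Suc t) s'"
| while_true: "test_val b s \<Longrightarrow> exec P s t s' \<Longrightarrow> exec (While b P) s' u s'' \<Longrightarrow>
    exec (While b P) s (Suc (t + u)) s''"
| while_false: "\<not> test_val b s \<Longrightarrow> exec (While b P) s 1 s"

inductive_cases exec_SkipE: "exec Skip s t s'"
inductive_cases exec_AssignE: "exec (Assign x e) s t s'"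
inductive_cases exec_WriteE: "exec (Write a e f g) s t s'"
inductive_cases exec_SeqE: "exec (Seq P Q) s t s'"
inductive_cases exec_IfE: "exec (If b P Q) s t s'"
inductive_cases exec_WhileE: "exec (While b P) s t s'"

lemma exec_deterministic:
  "exec P s t s' \<Longrightarrow> exec P s u s'' \<Longrightarrow> t = u \<and> s' = s''"
proof (induction arbitrary: u s'' rule: exec.induct)
  case (skip s) then show ?case by (auto elim: exec_SkipE)
next
  case (assign x e s) then show ?case by (auto elim: exec_AssignE)
next
  case (store a e f g s) then show ?case by (auto elim: exec_WriteE)
next
  case (seq P s t s' Q u' s1) then show ?case by (blast elim: exec_SeqE)
next
  case (if_true b s P t s' Q) then show ?case by (blast elim: exec_IfE)
next
  case (if_false b s Q t s' P) then show ?case by (blast elim: exec_IfE)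
next
  case (while_true b s P t s' u' s1)
  from while_true.prems while_true.hyps(1) obtain t2 s2 u2 where
    "exec P s t2 s2" "exec (While b P) s2 u2 s''" "u = Suc (t2 + u2)"
    by (auto elim: exec_WhileE)
  with while_true.IH show ?case by blast
next
  case (while_false b s P) then show ?case by (auto elim: exec_WhileE)
qed


section \<open>Input and output\<close>

text \<open>The machine works with the numbering \<open>e\<close> of \<open>\<Omega>\<close> by \<open>{..<card \<Omega>}\<close>.\<close>

definition point_number :: "'a set \<Rightarrow> (nat \<Rightarrow> 'a) \<Rightarrow> 'a \<Rightarrow> nat" where
  "point_number \<Omega> e x = inv_into {..<card \<Omega>} e x"

definition perm_table :: "'a set \<Rightarrow> (nat \<Rightarrow> 'a) \<Rightarrow> ('a \<Rightarrow> 'a) list \<Rightarrow> nat \<Rightarrow> nat \<Rightarrow> nat" where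
  "perm_table \<Omega> e ps = (\<lambda>k i. if k < length ps \<and> i < card \<Omega>
     then point_number \<Omega> e ((ps ! k) (e i)) else 0)"

definition point_table :: "'a set \<Rightarrow> (nat \<Rightarrow> 'a) \<Rightarrow> 'a list \<Rightarrow> nat \<Rightarrow> nat \<Rightarrow> nat" where
  "point_table \<Omega> e bs = (\<lambda>k i. if k = 0 \<and> i < length bs then point_number \<Omega> e (bs ! i) else 0)"

definition input_state ::
    "'a set \<Rightarrow> (nat \<Rightarrow> 'a) \<Rightarrow> ('a \<Rightarrow> 'a) list \<Rightarrow> nat \<Rightarrow> 'a list \<Rightarrow> ('a \<Rightarrow> 'a) list \<Rightarrow> state" where
  "input_state \<Omega> e ss L bs gs = \<lparr>
     regs = (\<lambda>_. 0)(''n'' := card \<Omega>, ''s'' := length ss, ''L'' := L),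
     tabs = (\<lambda>_ _ _. 0)(''gens'' := perm_table \<Omega> e ss,
                       ''base'' := point_table \<Omega> e bs,
                       ''cert'' := perm_table \<Omega> e gs)\<rparr>"

text \<open>A partition of \<open>\<Omega>\<close> is returned as a labelling of the points by words: two points lie in
  the same cell iff they carry the same label.\<close>

definition output_partition :: "'a set \<Rightarrow> (nat \<Rightarrow> 'a) \<Rightarrow> state \<Rightarrow> 'a set set" where
  "output_partition \<Omega> e s =
     {e ` {j. j < card \<Omega> \<and> tabs s ''cell'' 0 j = tabs s ''cell'' 0 i} | i. i < card \<Omega>}"

end

theory Submission
  imports Defs
begin

text \<open>Let \<open>\<Sigma>\<close> be a block system on which all nonredundant bases have length at most \<open>L\<close>, and replace
  each \<open>\<beta>\<^sub>i\<close> by the block containing it. The resulting list has length \<open>L + 1\<close>, so the certificate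
  cannot show it to be nonredundant, since otherwise it would extend to a nonredundant base that is
  too long. As \<open>g\<^sub>i\<close> fixes the blocks of the earlier points, some \<open>g\<^sub>i\<close> must fix the block of
  \<open>\<beta>\<^sub>i\<close> as well, which means that the two distinct points \<open>\<beta>\<^sub>i\<close> and \<open>g\<^sub>i \<beta>\<^sub>i\<close> lie in a common
  block (\<open>exists_certificate_in_block\<close>). For this \<open>i\<close> the least equivalence relation which
  contains the pair \<open>(\<beta>\<^sub>i, g\<^sub>i \<beta>\<^sub>i)\<close> and is preserved by the generators is finer than \<open>\<Sigma>\<close>, so it has
  more than one class. Conversely, whenever such a relation has more than one class, its
  classes form a block system (\<open>block_system_level_sets\<close>), because on a finite set a permutation that
  preserves an equivalence relation also reflects it. Hence it suffices to compute this relation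
  for each \<open>i\<close> in turn and to return the first one that is not total.

  The relation is computed by closing a forest of points under the generators. Every non-root point
  \<open>c\<close> stands for the edge from \<open>c\<close> to its parent. These edges generate the current relation, so it is
  stable as soon as the image of each edge under each generator lies inside a class
  (\<open>forest_stable\<close>). A point becomes a non-root at most once and keeps its parent from then on, so
  a queue of the non-root points never holds more than \<open>n\<close> entries, and each entry costs one union
  for every generator. With union by rank the rank strictly increases towards the root and
  never exceeds \<open>log n\<close> (\<open>forest_rank_bound\<close>), so a union takes \<open>O(log n)\<close> steps. One value
  of \<open>i\<close> therefore costs \<open>O(n |S| log n)\<close>, and there are \<open>L + 1\<close> of them.

  Root maps are not stored by the program; they occur in the invariants as a function \<open>f\<close>
  sending each point to its root, so that the current relation is equality of \<open>f\<close>-values.\<close>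

section \<open>Programs with a time bound\<close>

text \<open>Total correctness with a bound on the steps: as programs are deterministic, the existential
  quantifier speaks of the only run there is.\<close>

definition runs :: "prog \<Rightarrow> state \<Rightarrow> nat \<Rightarrow> (state \<Rightarrow> bool) \<Rightarrow> bool" where
  "runs P s T Q \<longleftrightarrow> (\<exists>t s'. exec P s t s' \<and> t \<le> T \<and> Q s')"

lemma runs_weaken:
  assumes "runs P s T Q" "T \<le> T'" "\<And>s'. Q s' \<Longrightarrow> Q' s'"
  shows "runs P s T' Q'"
  using assms unfolding runs_def by (meson le_trans)

lemma runs_Skip: "1 \<le> T \<Longrightarrow> Q s \<Longrightarrow> runs Skip s T Q"
  unfolding runs_def by (blast intro: exec.skip)

lemma runs_Assign: "1 \<le> T \<Longrightarrow> Q (set_reg x (expr_val e s) s) \<Longrightarrow> runs (Assign x e) s T Q"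
  unfolding runs_def by (blast intro: exec.assign)

lemma runs_Write:
  "1 \<le> T \<Longrightarrow> Q (set_tab a (expr_val e s) (expr_val f s) (expr_val g s) s) \<Longrightarrow>
    runs (Write a e f g) s T Q"
  unfolding runs_def by (blast intro: exec.store)

lemma runs_Seq:
  assumes "runs P s T (\<lambda>s'. runs Q s' U R)" "T + U \<le> V"
  shows "runs (Seq P Q) s V R"
proof -
  obtain t s' u s'' where "exec P s t s'" "t \<le> T" "exec Q s' u s''" "u \<le> U" "R s''"
    using assms(1) unfolding runs_def by blast
  then show ?thesis
    using assms(2) exec.seq[of P s t s' Q u s''] unfolding runs_def
    by (intro exI[of _ "t + u"] exI[of _ s'']) auto
qed

lemma runs_If:
  assumes "test_val b s \<Longrightarrow> runs P s T R" "\<not> test_val b s \<Longrightarrow> runs Q s T R" "Suc T \<le> V"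
  shows "runs (If b P Q) s V R"
proof (cases "test_val b s")
  case True
  then obtain t s' where "exec P s t s'" "t \<le> T" "R s'" using assms unfolding runs_def by blast
  then show ?thesis using True assms(3) exec.if_true[of b s P t s' Q] unfolding runs_def
    by (intro exI[of _ "Suc t"] exI[of _ s']) auto
next
  case False
  then obtain t s' where "exec Q s t s'" "t \<le> T" "R s'" using assms unfolding runs_def by blast
  then show ?thesis using False assms(3) exec.if_false[of b s Q t s' P] unfolding runs_def
    by (intro exI[of _ "Suc t"] exI[of _ s']) auto
qed

text \<open>The variant \<open>\<mu>\<close> proves termination and at the same time counts the iterations. Each one is
  charged \<open>B\<close> steps for the body and one for the test, and the final test is the additional step.\<close>

lemma runs_While:
  assumes inv: "I s"
    and body: "\<And>s. I s \<Longrightarrow> test_val b s \<Longrightarrow> runs P s B (\<lambda>s'. I s' \<and> \<mu> s' < (\<mu> s :: nat))"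
    and T: "\<mu> s * Suc B + 1 \<le> T"
    and post: "\<And>s. I s \<Longrightarrow> \<not> test_val b s \<Longrightarrow> Q s"
  shows "runs (While b P) s T Q"
proof -
  have "runs (While b P) s (\<mu> s * Suc B + 1) Q" using inv
  proof (induction "\<mu> s" arbitrary: s rule: less_induct)
    case less
    show ?case
    proof (cases "test_val b s")
      case True
      from body[OF less.prems True] obtain t s' where
        1: "exec P s t s'" "t \<le> B" "I s'" "\<mu> s' < \<mu> s" unfolding runs_def by blast
      from less.hyps[OF 1(4,3)] obtain u s'' where
        2: "exec (While b P) s' u s''" "u \<le> \<mu> s' * Suc B + 1" "Q s''" unfolding runs_def by blast
      have "Suc (\<mu> s') * Suc B \<le> \<mu> s * Suc B"
        using 1(4) by (intro mult_right_mono) auto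
      then have "Suc (t + u) \<le> \<mu> s * Suc B + 1" using 1(2) 2(2) by simp
      then show ?thesis unfolding runs_def
        using exec.while_true[OF True 1(1) 2(1)] 2(3) by blast
    next
      case False
      then show ?thesis unfolding runs_def using exec.while_false[OF False] post[OF less.prems]
        by (intro exI[of _ 1] exI[of _ s]) auto
    qed
  qed
  then show ?thesis by (rule runs_weaken) (use T in auto)
qed

lemma runs_Assign_Seq:
  "1 \<le> T \<Longrightarrow> runs P (set_reg x (expr_val e s) s) (T - 1) Q \<Longrightarrow> runs (Seq (Assign x e) P) s T Q"
  by (rule runs_Seq[where T = 1 and U = "T - 1"]) (auto intro: runs_Assign)

lemma runs_Write_Seq:
  "1 \<le> T \<Longrightarrow> runs P (set_tab a (expr_val e s) (expr_val f s) (expr_val g s) s) (T - 1) Q \<Longrightarrow>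
    runs (Seq (Write a e f g) P) s T Q"
  by (rule runs_Seq[where T = 1 and U = "T - 1"]) (auto intro: runs_Write)

lemmas runs_simple = runs_Skip runs_Assign runs_Write runs_Assign_Seq runs_Write_Seq

lemma regs_set_reg [simp]: "regs (set_reg x v s) = (regs s)(x := v)"
  and tabs_set_reg [simp]: "tabs (set_reg x v s) = tabs s"
  and regs_set_tab [simp]: "regs (set_tab a i j v s) = regs s"
  and tabs_set_tab [simp]:
    "tabs (set_tab a i j v s) = (tabs s)(a := (tabs s a)(i := (tabs s a i)(j := v)))"
  by (simp_all add: set_reg_def set_tab_def)

lemma set_reg_same [simp]: "set_reg x (regs s x) s = s"
  and set_reg_twice [simp]: "set_reg x v (set_reg x w s) = set_reg x v s"
  by (simp_all add: set_reg_def)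


section \<open>Forests with union by rank\<close>

text \<open>Parents \<open>p\<close>, ranks \<open>r\<close>, a queue \<open>q\<close> with \<open>m\<close> entries, and the map \<open>f\<close> from points to roots. The first line
  determines \<open>f\<close>, because ranks increase along parents. A root of rank \<open>k\<close> has a class of at least
  \<open>2 ^ k\<close> points, which is what bounds the ranks. The queue has no repetitions, since its \<open>m\<close> entries
  exhaust a set of \<open>m\<close> points.\<close>

definition forest ::
    "nat \<Rightarrow> (nat \<Rightarrow> nat) \<Rightarrow> (nat \<Rightarrow> nat) \<Rightarrow> (nat \<Rightarrow> nat) \<Rightarrow> nat \<Rightarrow> (nat \<Rightarrow> nat) \<Rightarrow> bool" where
  "forest n p r q m f \<longleftrightarrow>
     (\<forall>x<n. f x < n \<and> p x < n \<and> p (f x) = f x \<and> f (p x) = f x \<and> (p x = x \<longrightarrow> f x = x)) \<and>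
     (\<forall>x<n. p x \<noteq> x \<longrightarrow> r x < r (p x)) \<and> (\<forall>x<n. r x \<le> r (f x)) \<and>
     (\<forall>x<n. f x = x \<longrightarrow> 2 ^ r x \<le> card {y. y < n \<and> f y = x}) \<and>
     q ` {..<m} = {x. x < n \<and> p x \<noteq> x} \<and> m = card {x. x < n \<and> p x \<noteq> x}"

lemma forestD:
  assumes "forest n p r q m f" "x < n"
  shows "f x < n" "p x < n" "p (f x) = f x" "f (p x) = f x" "p x = x \<longleftrightarrow> f x = x" "f (f x) = f x"
    "p x \<noteq> x \<Longrightarrow> r x < r (p x)" "r x \<le> r (f x)"
    "f x = x \<Longrightarrow> 2 ^ r x \<le> card {y. y < n \<and> f y = x}"
proof -
  have *: "f x < n \<and> p x < n \<and> p (f x) = f x \<and> f (p x) = f x \<and> (p x = x \<longrightarrow> f x = x)"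
    if "x < n" for x
    using assms(1) that unfolding forest_def by blast
  from *[OF assms(2)] *[of "f x"]
  show "f x < n" "p x < n" "p (f x) = f x" "f (p x) = f x" "p x = x \<longleftrightarrow> f x = x" "f (f x) = f x"
    by auto
  show "p x \<noteq> x \<Longrightarrow> r x < r (p x)" "r x \<le> r (f x)"
    "f x = x \<Longrightarrow> 2 ^ r x \<le> card {y. y < n \<and> f y = x}"
    using assms unfolding forest_def by blast+
qed

lemma forest_queue:
  assumes "forest n p r q m f"
  shows "q ` {..<m} = {x. x < n \<and> p x \<noteq> x}" "m = card {x. x < n \<and> p x \<noteq> x}"
  using assms unfolding forest_def by blast+

lemma forest_rank_bound:
  assumes F: "forest n p r q m f" and x: "x < n"
  shows "2 ^ r x \<le> n"
proof -
  note D = forestD[OF F]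
  have "2 ^ r x \<le> (2 :: nat) ^ r (f x)" using D(8)[OF x] by (simp add: power_increasing)
  also have "\<dots> \<le> card {y. y < n \<and> f y = f x}" using D(9)[of "f x"] D(1,6)[OF x] by simp
  also have "\<dots> \<le> card {..<n}" by (rule card_mono) auto
  finally show ?thesis by simp
qed

text \<open>Each entry of the queue records a union, and a union lowers the number of classes by one.
  The program reads off from \<open>m\<close> alone whether a single class is left.\<close>

lemma forest_roots_card:
  assumes F: "forest n p r q m f"
  shows "card (f ` {..<n}) + m = n"
proof -
  have "f ` {..<n} = {x. x < n \<and> p x = x}"
  proof (intro equalityI subsetI)
    fix z assume "z \<in> f ` {..<n}"
    then show "z \<in> {x. x < n \<and> p x = x}" using forestD(1,3)[OF F] by auto
  next
    fix z assume "z \<in> {x. x < n \<and> p x = x}"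
    then show "z \<in> f ` {..<n}" using forestD(5)[OF F] by (intro image_eqI[of _ _ z]) auto
  qed
  moreover have "{..<n} = {x. x < n \<and> p x = x} \<union> {x. x < n \<and> p x \<noteq> x}" by auto
  then have "card {..<n} = card {x. x < n \<and> p x = x} + card {x. x < n \<and> p x \<noteq> x}"
    by (metis (mono_tags, lifting) card_Un_disjoint disjoint_iff finite_Un finite_lessThan
        mem_Collect_eq)
  ultimately show ?thesis using forest_queue(2)[OF F] by simp
qed

lemma forest_init:
  assumes "\<And>x. x < n \<Longrightarrow> p x = x" "\<And>x. x < n \<Longrightarrow> r x = 0"
  shows "forest n p r q 0 (\<lambda>x. x)"
proof -
  have "{y. y < n \<and> y = x} = {x}" if "x < n" for x using that by auto
  moreover have "{x. x < n \<and> p x \<noteq> x} = {}" using assms by auto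
  ultimately show ?thesis using assms unfolding forest_def by simp
qed

text \<open>The rank of \<open>b\<close> grows only if it equals that of \<open>a\<close>; then both classes have at least \<open>2 ^ r b\<close>
  points and their union at least twice as many.\<close>

lemma forest_link:
  assumes F: "forest n p r q m f" and a: "a < n" "f a = a" and b: "b < n" "f b = b"
    and ab: "a \<noteq> b" and r: "r a \<le> r b"
  shows "forest n (p(a := b)) (if r a = r b then r(b := Suc (r b)) else r) (q(m := a)) (Suc m)
    (\<lambda>x. if f x = a then b else f x)" (is "forest n ?p ?r ?q _ ?f")
proof -
  note D = forestD[OF F]
  have pa: "p a = a" "p b = b" using D(5) a b by auto
  have set: "{x. x < n \<and> ?p x \<noteq> x} = insert a {x. x < n \<and> p x \<noteq> x}"
    using a ab pa by auto
  have cls: "{y. y < n \<and> ?f y = b} = {y. y < n \<and> f y = a} \<union> {y. y < n \<and> f y = b}"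
    using ab by auto
  have "card {y. y < n \<and> ?f y = b} = card {y. y < n \<and> f y = a} + card {y. y < n \<and> f y = b}"
    unfolding cls by (rule card_Un_disjoint) (use ab in auto)
  then have sz: "2 ^ r a + 2 ^ r b \<le> card {y. y < n \<and> ?f y = b}"
    using D(9)[OF a] D(9)[OF b] by simp
  have "?f x < n \<and> ?p x < n \<and> ?p (?f x) = ?f x \<and> ?f (?p x) = ?f x \<and> (?p x = x \<longrightarrow> ?f x = x)"
    if "x < n" for x
    using D[OF that] a b ab pa by auto
  moreover have "?r x < ?r (?p x)" if "x < n" "?p x \<noteq> x" for x
    using D(2-7)[OF that(1)] that(2) r pa a b ab by (auto split: if_splits)
  moreover have "?r x \<le> ?r (?f x)" if "x < n" for x
    using D(8)[OF that] r ab b by (auto split: if_splits)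
  moreover have "2 ^ ?r x \<le> card {y. y < n \<and> ?f y = x}" if "x < n" "?f x = x" for x
  proof (cases "x = b")
    case True
    have "(2::nat) ^ ?r b \<le> 2 ^ r a + 2 ^ r b" by simp
    then show ?thesis unfolding True using sz by (rule le_trans)
  next
    case False
    then have "f x = x" "x \<noteq> a" using that by (auto split: if_splits)
    moreover from this False have "{y. y < n \<and> ?f y = x} = {y. y < n \<and> f y = x}" by auto
    ultimately show ?thesis using D(9)[OF that(1)] False by simp
  qed
  moreover have "?q ` {..<Suc m} = {x. x < n \<and> ?p x \<noteq> x}"
    unfolding set forest_queue(1)[OF F, symmetric] by (auto simp: lessThan_Suc)
  moreover have "Suc m = card {x. x < n \<and> ?p x \<noteq> x}"
    unfolding set forest_queue(2)[OF F] using pa by (subst card_insert_disjoint) auto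
  ultimately show ?thesis unfolding forest_def by blast
qed

lemma forest_induct [consumes 2, case_names root parent]:
  assumes F: "forest n p r q m f" and x: "x < n"
    and root: "\<And>x. x < n \<Longrightarrow> f x = x \<Longrightarrow> P x"
    and parent: "\<And>x. x < n \<Longrightarrow> p x \<noteq> x \<Longrightarrow> P (p x) \<Longrightarrow> P x"
  shows "P x"
  using x
proof (induction "n - r x" arbitrary: x rule: less_induct)
  case less
  show ?case
  proof (cases "p x = x")
    case True
    then show ?thesis using root forestD(5)[OF F] less.prems by blast
  next
    case False
    have "p x < n" by (rule forestD(2)[OF F less.prems])
    moreover have "r (p x) < n"
      using forest_rank_bound[OF F \<open>p x < n\<close>] less_exp[of "r (p x)"] by linarith
    ultimately show ?thesis
      using less forestD(7)[OF F less.prems False] parent False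
      by (metis diff_less_mono2 order_less_trans)
  qed
qed

section \<open>Stable equivalence relations\<close>

definition stable_equiv :: "'b set \<Rightarrow> ('b \<Rightarrow> 'b) set \<Rightarrow> ('b \<times> 'b) set \<Rightarrow> bool" where
  "stable_equiv A F E \<longleftrightarrow> equiv A E \<and> (\<forall>g\<in>F. \<forall>(x, y)\<in>E. (g x, g y) \<in> E)"

definition generated_equiv :: "'b set \<Rightarrow> ('b \<Rightarrow> 'b) set \<Rightarrow> 'b \<Rightarrow> 'b \<Rightarrow> ('b \<times> 'b) set" where
  "generated_equiv A F a b = \<Inter>{E. stable_equiv A F E \<and> (a, b) \<in> E}"

definition same_value :: "'b set \<Rightarrow> ('b \<Rightarrow> 'c) \<Rightarrow> ('b \<times> 'b) set" where
  "same_value A f = {(x, y). x \<in> A \<and> y \<in> A \<and> f x = f y}"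

lemma same_value_iff [simp]: "(x, y) \<in> same_value A f \<longleftrightarrow> x \<in> A \<and> y \<in> A \<and> f x = f y"
  by (simp add: same_value_def)

lemma generated_equiv_least:
  assumes "stable_equiv A F E" "(a, b) \<in> E"
  shows "generated_equiv A F a b \<subseteq> E"
  unfolding generated_equiv_def by (rule Inter_lower) (use assms in simp)

lemma stable_equiv_generated:
  assumes "a \<in> A" "b \<in> A" "\<And>g x. g \<in> F \<Longrightarrow> x \<in> A \<Longrightarrow> g x \<in> A"
  shows "stable_equiv A F (generated_equiv A F a b)" "(a, b) \<in> generated_equiv A F a b"
proof -
  have U: "stable_equiv A F (A \<times> A)" "(a, b) \<in> A \<times> A"
    using assms by (auto simp: stable_equiv_def equiv_def refl_on_def sym_def trans_def)
  have *: "generated_equiv A F a b \<subseteq> A \<times> A" by (rule generated_equiv_least[OF U])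
  have m: "(x, y) \<in> generated_equiv A F a b \<longleftrightarrow> (\<forall>E. stable_equiv A F E \<longrightarrow> (a, b) \<in> E \<longrightarrow> (x, y) \<in> E)"
    for x y unfolding generated_equiv_def by auto
  have "equiv A (generated_equiv A F a b)"
  proof (rule equivI)
    show "generated_equiv A F a b \<subseteq> A \<times> A" by (rule *)
    show "refl_on A (generated_equiv A F a b)"
      using * unfolding refl_on_def m by (auto simp: stable_equiv_def equiv_def refl_on_def)
    show "sym (generated_equiv A F a b)"
      unfolding sym_def m by (auto simp: stable_equiv_def equiv_def sym_def)
    show "trans (generated_equiv A F a b)"
      unfolding trans_def m stable_equiv_def equiv_def by blast
  qed
  moreover have "(g x, g y) \<in> generated_equiv A F a b"
    if "g \<in> F" "(x, y) \<in> generated_equiv A F a b" for g x y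
    using that unfolding m stable_equiv_def by blast
  ultimately show "stable_equiv A F (generated_equiv A F a b)" unfolding stable_equiv_def by blast
  show "(a, b) \<in> generated_equiv A F a b" unfolding m by blast
qed

lemma equiv_same_value: "equiv A (same_value A f)"
  by (auto simp: same_value_def equiv_def refl_on_def sym_def trans_def)

text \<open>Once the queue is exhausted, every edge from a point to its parent is mapped into a class by
  every generator; following the path to the root carries this over to the whole class.\<close>

lemma forest_stable:
  assumes F: "forest n p r q m f" and G: "\<And>g x. g \<in> G \<Longrightarrow> x < n \<Longrightarrow> g x < n"
    and edge: "\<And>k g. k < m \<Longrightarrow> g \<in> G \<Longrightarrow> f (g (q k)) = f (g (p (q k)))"
  shows "stable_equiv {..<n} G (same_value {..<n} f)"
proof -
  have "f (g x) = f (g (f x))" if "g \<in> G" "x < n" for g x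
    using F that(2)
  proof (induction x rule: forest_induct)
    case (root x)
    then show ?case by simp
  next
    case (parent x)
    then have "x \<in> q ` {..<m}" unfolding forest_queue(1)[OF F] by simp
    then have "f (g x) = f (g (p x))" using edge[OF _ that(1)] by auto
    then show ?case using parent forestD(4)[OF F] by simp
  qed
  then have "f (g x) = f (g y)" if "g \<in> G" "x < n" "y < n" "f x = f y" for g x y
    using that by metis
  then show ?thesis using equiv_same_value[of "{..<n}" f] G
    unfolding stable_equiv_def same_value_def by auto
qed


lemma forest_total:
  assumes F: "forest n p r q m f" and n: "0 < n"
  shows "same_value {..<n} f = {..<n} \<times> {..<n} \<longleftrightarrow> n \<le> Suc m"
proof
  assume "same_value {..<n} f = {..<n} \<times> {..<n}"
  then have "f x = f 0" if "x < n" for x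
    using that n unfolding same_value_def by blast
  then have "f ` {..<n} \<subseteq> {f 0}" by blast
  then have "card (f ` {..<n}) \<le> 1" using card_mono[of "{f 0}" "f ` {..<n}"] by simp
  then show "n \<le> Suc m" using forest_roots_card[OF F] by linarith
next
  assume "n \<le> Suc m"
  then have "card (f ` {..<n}) \<le> Suc 0" using forest_roots_card[OF F] by linarith
  then have "f x = f y" if "x < n" "y < n" for x y
    using that card_le_Suc0_iff_eq[of "f ` {..<n}"] by blast
  then show "same_value {..<n} f = {..<n} \<times> {..<n}" by (auto simp: same_value_def)
qed

section \<open>The program\<close>

text \<open>The registers \<open>x\<close> and \<open>y\<close> hold the two points to be united, \<open>m\<close> counts the entries of the queue and
  \<open>h\<close> those already processed, \<open>c\<close> is the entry being processed and \<open>k\<close> the number of the generator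
  applied to its edge; \<open>i\<close> numbers the pairs of the certificate, and \<open>d\<close> becomes 1 once a relation
  with more than one class has been found.\<close>

abbreviation "par x \<equiv> Read ''par'' (Const 0) x"
abbreviation "rank x \<equiv> Read ''rank'' (Const 0) x"
abbreviation "queue x \<equiv> Read ''queue'' (Const 0) x"

definition find_root :: "string \<Rightarrow> prog" where
  "find_root v = While (Neg (Equal (par (Reg v)) (Reg v))) (Assign v (par (Reg v)))"

text \<open>The swap makes \<open>x\<close> the root of smaller rank, which becomes the child and enters the queue.\<close>

definition link :: prog where
  "link =
    Seq (If (Less (rank (Reg ''y'')) (rank (Reg ''x'')))
          (Seq (Assign ''t'' (Reg ''x'')) (Seq (Assign ''x'' (Reg ''y'')) (Assign ''y'' (Reg ''t''))))
          Skip)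
    (Seq (Write ''par'' (Const 0) (Reg ''x'') (Reg ''y''))
    (Seq (Write ''queue'' (Const 0) (Reg ''m'') (Reg ''x''))
    (Seq (If (Equal (rank (Reg ''x'')) (rank (Reg ''y'')))
          (Write ''rank'' (Const 0) (Reg ''y'') (Inc (rank (Reg ''y''))))
          Skip)
      (Assign ''m'' (Inc (Reg ''m''))))))"

definition unite :: prog where
  "unite = Seq (find_root ''x'') (Seq (find_root ''y'') (If (Equal (Reg ''x'') (Reg ''y'')) Skip link))"

definition initialize :: prog where
  "initialize = While (Less (Reg ''j'') (Reg ''n''))
    (Seq (Write ''par'' (Const 0) (Reg ''j'') (Reg ''j''))
    (Seq (Write ''rank'' (Const 0) (Reg ''j'') (Const 0))
      (Assign ''j'' (Inc (Reg ''j'')))))"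

definition close_edge :: prog where
  "close_edge = While (Less (Reg ''k'') (Reg ''s''))
    (Seq (Assign ''x'' (Read ''gens'' (Reg ''k'') (Reg ''c'')))
    (Seq (Assign ''y'' (Read ''gens'' (Reg ''k'') (par (Reg ''c''))))
    (Seq unite (Assign ''k'' (Inc (Reg ''k''))))))"

definition saturate :: prog where
  "saturate = While (Less (Reg ''h'') (Reg ''m''))
    (Seq (Assign ''c'' (queue (Reg ''h'')))
    (Seq (Assign ''k'' (Const 0))
    (Seq close_edge (Assign ''h'' (Inc (Reg ''h''))))))"

definition attempt :: prog where
  "attempt =
    Seq (Assign ''j'' (Const 0)) (Seq initialize
    (Seq (Assign ''h'' (Const 0)) (Seq (Assign ''m'' (Const 0))
    (Seq (Assign ''x'' (Read ''base'' (Const 0) (Reg ''i'')))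
    (Seq (Assign ''y'' (Read ''cert'' (Reg ''i'') (Reg ''x'')))
    (Seq unite (Seq saturate
    (Seq (If (Less (Inc (Reg ''m'')) (Reg ''n'')) (Assign ''d'' (Const 1)) Skip)
      (Assign ''i'' (Inc (Reg ''i'')))))))))))"

definition search :: prog where
  "search = While (Conj (Less (Reg ''i'') (Inc (Reg ''L''))) (Equal (Reg ''d'') (Const 0))) attempt"

definition label :: prog where
  "label = While (Less (Reg ''j'') (Reg ''n''))
    (Seq (Assign ''x'' (Reg ''j'')) (Seq (find_root ''x'')
    (Seq (Write ''cell'' (Const 0) (Reg ''j'') (Reg ''x''))
      (Assign ''j'' (Inc (Reg ''j''))))))"

definition find_blocks :: prog where
  "find_blocks = Seq search (Seq (Assign ''j'' (Const 0)) label)"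

text \<open>The frame condition: only the registers in \<open>X\<close> and the tables in \<open>Y\<close> may differ.\<close>

definition agree :: "string set \<Rightarrow> string set \<Rightarrow> state \<Rightarrow> state \<Rightarrow> bool" where
  "agree X Y s s' \<longleftrightarrow>
    (\<forall>v. v \<notin> X \<longrightarrow> regs s' v = regs s v) \<and> (\<forall>a. a \<notin> Y \<longrightarrow> tabs s' a = tabs s a)"

lemma agree_refl: "agree X Y s s"
  by (simp add: agree_def)

lemma agree_trans: "agree X Y s s' \<Longrightarrow> agree X' Y' s' s'' \<Longrightarrow> X' \<subseteq> X \<Longrightarrow> Y' \<subseteq> Y \<Longrightarrow> agree X Y s s''"
  unfolding agree_def by (metis subsetD)

lemma agree_set_reg: "agree X Y s s' \<Longrightarrow> v \<in> X \<Longrightarrow> agree X Y s (set_reg v w s')"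
  by (auto simp: agree_def)

lemma agree_set_tab: "agree X Y s s' \<Longrightarrow> a \<in> Y \<Longrightarrow> agree X Y s (set_tab a i j w s')"
  by (auto simp: agree_def)

lemmas agree_intros = agree_refl agree_set_reg agree_set_tab

lemma agreeD: "agree X Y s s' \<Longrightarrow> v \<notin> X \<Longrightarrow> regs s' v = regs s v"
  "agree X Y s s' \<Longrightarrow> a \<notin> Y \<Longrightarrow> tabs s' a = tabs s a"
  by (auto simp: agree_def)

abbreviation forest_in :: "nat \<Rightarrow> state \<Rightarrow> (nat \<Rightarrow> nat) \<Rightarrow> bool" where
  "forest_in n s f \<equiv>
    forest n (tabs s ''par'' 0) (tabs s ''rank'' 0) (tabs s ''queue'' 0) (regs s ''m'') f"

lemma forest_rank_le:
  assumes "forest n p r q m f" "n < 2 ^ Suc K" "x < n"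
  shows "r x \<le> K"
proof -
  have "2 ^ r x < (2::nat) ^ Suc K" using forest_rank_bound[OF assms(1,3)] assms(2) by linarith
  then show ?thesis using power_less_imp_less_exp[of "2::nat" "r x" "Suc K"] by simp
qed

text \<open>The rank of the current point increases with every step and is at most \<open>K\<close>.\<close>

lemma runs_find_root:
  assumes F: "forest n (tabs s ''par'' 0) r q m f" and K: "n < 2 ^ Suc K"
    and v: "regs s v < n" and T: "2 * K + 1 \<le> T" and Q: "Q (set_reg v (f (regs s v)) s)"
  shows "runs (find_root v) s T Q"
  unfolding find_root_def
proof (rule runs_While[where B = 1 and \<mu> = "\<lambda>s. K - r (regs s v)"
      and I = "\<lambda>s'. \<exists>z<n. f z = f (regs s v) \<and> s' = set_reg v z s"])
  let ?I = "\<lambda>s'. \<exists>z<n. f z = f (regs s v) \<and> s' = set_reg v z s"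
  let ?p = "tabs s ''par'' 0"
  note D = forestD[OF F]
  show "?I s" using v by (intro exI[of _ "regs s v"]) simp
  show "(K - r (regs s v)) * Suc 1 + 1 \<le> T" using T by simp
  fix s' assume "?I s'"
  then obtain z where z: "z < n" "f z = f (regs s v)" and s': "s' = set_reg v z s" by blast
  {
    assume t: "test_val (Neg (Equal (par (Reg v)) (Reg v))) s'"
    then have "?p z \<noteq> z" by (simp add: s')
    then have "r z < r (?p z)" "r (?p z) \<le> K" "?p z < n" "f (?p z) = f (regs s v)"
      using D(2,4,7)[OF z(1)] z forest_rank_le[OF F K] by auto
    then show "runs (Assign v (par (Reg v))) s' 1
        (\<lambda>s''. ?I s'' \<and> K - r (regs s'' v) < K - r (regs s' v))"
      by (intro runs_Assign) (auto simp: s')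
  next
    assume "\<not> test_val (Neg (Equal (par (Reg v)) (Reg v))) s'"
    then have "f z = z" using D(5)[OF z(1)] by (simp add: s')
    then show "Q s'" using Q z s' by simp
  }
qed

text \<open>Equality of \<open>f\<close>-values after the classes of \<open>a\<close> and \<open>b\<close> have been joined. Which of the two roots
  survives depends on the ranks, so only the relation is described, not \<open>f\<close>.\<close>

definition merged :: "nat \<Rightarrow> (nat \<Rightarrow> nat) \<Rightarrow> nat \<Rightarrow> nat \<Rightarrow> (nat \<Rightarrow> nat) \<Rightarrow> bool" where
  "merged n f a b f' \<longleftrightarrow> (\<forall>u<n. \<forall>v<n. f' u = f' v \<longleftrightarrow>
     f u = f v \<or> f u \<in> {f a, f b} \<and> f v \<in> {f a, f b})"

text \<open>What the processed part of the queue relies on: entries stay in place, and a point that has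
  a proper parent keeps it.\<close>

definition extends :: "nat \<Rightarrow> state \<Rightarrow> state \<Rightarrow> bool" where
  "extends n s s' \<longleftrightarrow> regs s ''m'' \<le> regs s' ''m'' \<and>
     (\<forall>k<regs s ''m''. tabs s' ''queue'' 0 k = tabs s ''queue'' 0 k) \<and>
     (\<forall>u<n. tabs s ''par'' 0 u \<noteq> u \<longrightarrow> tabs s' ''par'' 0 u = tabs s ''par'' 0 u) \<and>
     agree {''x'', ''y'', ''t'', ''m''} {''par'', ''rank'', ''queue''} s s'"

lemma runs_link:
  assumes F: "forest_in n s f" and x: "regs s ''x'' = a" "a < n" "f a = a"
    and y: "regs s ''y'' = b" "b < n" "f b = b" and ab: "a \<noteq> b" and T: "9 \<le> T"
  shows "runs link s T (\<lambda>s'. (\<exists>f'. forest_in n s' f' \<and> merged n f a b f') \<and> extends n s s')"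
    (is "runs link s T ?Q")
proof -
  \<comment> \<open>After the swap, the registers hold the two roots \<open>u\<close> and \<open>v\<close> in the order of their ranks.\<close>
  let ?J = "\<lambda>s'. \<exists>u v. {u, v} = {a, b} \<and> tabs s ''rank'' 0 u \<le> tabs s ''rank'' 0 v \<and>
    regs s' ''x'' = u \<and> regs s' ''y'' = v \<and> tabs s' = tabs s \<and> regs s' ''m'' = regs s ''m'' \<and>
    agree {''x'', ''y'', ''t'', ''m''} {''par'', ''rank'', ''queue''} s s'"
  show ?thesis unfolding link_def
  proof (rule runs_Seq[where T = 4 and U = 5])
    have "runs (If (Less (rank (Reg ''y'')) (rank (Reg ''x'')))
       (Seq (Assign ''t'' (Reg ''x'')) (Seq (Assign ''x'' (Reg ''y'')) (Assign ''y'' (Reg ''t''))))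
       Skip) s 4 ?J"
    proof (rule runs_If[where T = 3], goal_cases)
      case 1
      then show ?case using x(1) y(1)
        by (intro runs_simple exI[of _ b] exI[of _ a]) (auto intro!: agree_intros)
    next
      case 2
      then show ?case using x(1) y(1)
        by (intro runs_simple exI[of _ a] exI[of _ b]) (auto intro!: agree_intros)
    qed auto
    then show "runs (If (Less (rank (Reg ''y'')) (rank (Reg ''x'')))
       (Seq (Assign ''t'' (Reg ''x'')) (Seq (Assign ''x'' (Reg ''y'')) (Assign ''y'' (Reg ''t''))))
       Skip) s 4 (\<lambda>s'. runs (Seq (Write ''par'' (Const 0) (Reg ''x'') (Reg ''y''))
        (Seq (Write ''queue'' (Const 0) (Reg ''m'') (Reg ''x''))
        (Seq (If (Equal (rank (Reg ''x'')) (rank (Reg ''y'')))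
              (Write ''rank'' (Const 0) (Reg ''y'') (Inc (rank (Reg ''y''))))
              Skip)
          (Assign ''m'' (Inc (Reg ''m'')))))) s' 5 ?Q)"
    proof (rule runs_weaken, goal_cases)
      case (2 s')
      then obtain u v where uv: "{u, v} = {a, b}" "tabs s ''rank'' 0 u \<le> tabs s ''rank'' 0 v"
        and s': "regs s' ''x'' = u" "regs s' ''y'' = v" "tabs s' = tabs s"
          "regs s' ''m'' = regs s ''m''"
        and agr: "agree {''x'', ''y'', ''t'', ''m''} {''par'', ''rank'', ''queue''} s s'"
        by blast
      have uv': "u < n" "f u = u" "v < n" "f v = v" "u \<noteq> v"
        using uv(1) x y ab by (auto simp: doubleton_eq_iff)
      note L = forest_link[OF F uv' uv(2)]
      let ?f = "\<lambda>x. if f x = u then v else f x"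
      have m: "merged n f a b ?f"
        using uv(1) uv' x y unfolding merged_def by (auto simp: doubleton_eq_iff)
      have pu: "tabs s ''par'' 0 u = u" using forestD(5)[OF F uv'(1)] uv'(2) by simp
      show ?case
      proof (intro runs_simple, simp, simp, rule runs_Seq[where T = 2 and U = 1],
          rule runs_If[where T = 1], goal_cases)
        case 1
        then have e: "tabs s ''rank'' 0 u = tabs s ''rank'' 0 v" by (simp add: s')
        show ?case
          by (intro runs_simple conjI exI[of _ ?f])
             (use L m e pu in \<open>auto simp: s' extends_def intro!: agree_intros agr\<close>)
      next
        case 2
        then have e: "tabs s ''rank'' 0 u \<noteq> tabs s ''rank'' 0 v" by (simp add: s')
        show ?case
          by (intro runs_simple conjI exI[of _ ?f])
             (use L m e pu in \<open>auto simp: s' extends_def intro!: agree_intros agr\<close>)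
      qed auto
    qed auto
  qed (use T in auto)
qed

lemma runs_unite:
  assumes F: "forest_in n s f" and K: "n < 2 ^ Suc K"
    and x: "regs s ''x'' = a" "a < n" and y: "regs s ''y'' = b" "b < n" and T: "4 * K + 12 \<le> T"
  shows "runs unite s T (\<lambda>s'. (\<exists>f'. forest_in n s' f' \<and> merged n f a b f') \<and> extends n s s')"
    (is "runs unite s T ?Q")
  unfolding unite_def
proof (rule runs_Seq[where T = "2 * K + 1" and U = "2 * K + 11"],
    rule runs_find_root[OF F K], goal_cases)
  case 3
  let ?s = "set_reg ''x'' (f (regs s ''x'')) s"
  have F1: "forest_in n ?s f" using F by simp
  show ?case
  proof (rule runs_Seq[where T = "2 * K + 1" and U = 10], rule runs_find_root[OF F1 K], goal_cases)
    case 3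
    let ?s' = "set_reg ''y'' (f (regs ?s ''y'')) ?s"
    have s': "regs ?s' ''x'' = f a" "regs ?s' ''y'' = f b" "forest_in n ?s' f"
      using x y F by auto
    have agr: "agree {''x'', ''y'', ''t'', ''m''} {''par'', ''rank'', ''queue''} s ?s'"
      by (auto intro!: agree_intros)
    show ?case
    proof (rule runs_If[where T = 9])
      assume "test_val (Equal (Reg ''x'') (Reg ''y'')) ?s'"
      then have "merged n f a b f" using s' by (auto simp: merged_def)
      then show "runs Skip ?s' 9 ?Q"
        using agr s'(3) by (intro runs_simple) (auto simp: extends_def)
    next
      assume "\<not> test_val (Equal (Reg ''x'') (Reg ''y'')) ?s'"
      then have ne: "f a \<noteq> f b" using s' by simp
      show "runs link ?s' 9 ?Q"
      proof (rule runs_weaken[OF runs_link[OF s'(3) s'(1) _ _ s'(2) _ _ ne order_refl]], goal_cases)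
        case (6 s'')
        then have "extends n ?s' s''" by blast
        then have "extends n s s''" using agree_trans[OF agr] unfolding extends_def by auto
        moreover have "merged n f a b f'" if "merged n f (f a) (f b) f'" for f'
          using that forestD(6)[OF F] x y unfolding merged_def by auto
        ultimately show ?case using 6 by blast
      qed (use forestD[OF F] x y in auto)
    qed auto
  qed (use y in auto)
qed (use x T in auto)

lemma merged_mono:
  assumes "merged n f a b f'" "u < n" "v < n" "f u = f v"
  shows "f' u = f' v"
  using assms unfolding merged_def by blast

lemma merged_joins: "merged n f a b f' \<Longrightarrow> a < n \<Longrightarrow> b < n \<Longrightarrow> f' a = f' b"
  unfolding merged_def by blast

lemma merged_within:
  assumes E: "equiv {..<n} E" and f: "same_value {..<n} f \<subseteq> E" and m: "merged n f a b f'"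
    and ab: "(a, b) \<in> E"
  shows "same_value {..<n} f' \<subseteq> E"
proof
  fix z assume "z \<in> same_value {..<n} f'"
  then obtain u v where z: "z = (u, v)" "u < n" "v < n" "f' u = f' v"
    unfolding same_value_def by auto
  have s: "sym E" and t: "trans E" using E by (auto elim: equivE)
  have "a < n" "b < n" using ab E by (auto dest: equiv_type)
  have f': "(x, y) \<in> E" if "f x = f y" "x < n" "y < n" for x y
    using f that by auto
  have ba: "(b, a) \<in> E" using ab s by (rule symD[rotated])
  from m z consider "f u = f v" | "f u = f a" "f v = f a" | "f u = f a" "f v = f b"
    | "f u = f b" "f v = f a" | "f u = f b" "f v = f b"
    unfolding merged_def by blast
  then show "z \<in> E"
  proof cases
    case 3
    then have "(u, a) \<in> E" "(b, v) \<in> E" using f' z \<open>a < n\<close> \<open>b < n\<close> by auto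
    then show ?thesis using ab t z(1) by (meson transD)
  next
    case 4
    then have "(u, b) \<in> E" "(a, v) \<in> E" using f' z \<open>a < n\<close> \<open>b < n\<close> by auto
    then show ?thesis using ba t z(1) by (meson transD)
  qed (use f' z in auto)
qed

section \<open>Correctness and running time of the program\<close>

text \<open>In the application \<open>K\<close> is the integral part of the binary logarithm of \<open>n\<close>. A point of rank \<open>k\<close>
  forces \<open>2 ^ k \<le> n\<close>, so the assumption on \<open>K\<close> bounds all ranks by it.\<close>

locale pair_input =
  fixes n ns L K :: nat and gens base cert :: "nat \<Rightarrow> nat \<Rightarrow> nat"
  assumes n_pos: "0 < n" and K: "n < 2 ^ Suc K"
    and gens: "\<And>k x. k < ns \<Longrightarrow> x < n \<Longrightarrow> gens k x < n"
    and base: "\<And>i. i \<le> L \<Longrightarrow> base 0 i < n"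
    and cert: "\<And>i x. i \<le> L \<Longrightarrow> x < n \<Longrightarrow> cert i x < n"
begin

definition loaded :: "state \<Rightarrow> bool" where
  "loaded s \<longleftrightarrow> regs s ''n'' = n \<and> regs s ''s'' = ns \<and> regs s ''L'' = L \<and>
     tabs s ''gens'' = gens \<and> tabs s ''base'' = base \<and> tabs s ''cert'' = cert"

lemma loaded_agree:
  assumes "loaded s" "agree X Y s s'" "X \<inter> {''n'', ''s'', ''L''} = {}" "Y \<inter> {''gens'', ''base'', ''cert''} = {}"
  shows "loaded s'"
  using assms unfolding loaded_def agree_def by auto

definition moves :: "(nat \<Rightarrow> nat) set" where
  "moves = gens ` {..<ns}"

text \<open>The invariant of the closure process. The forest never leaves \<open>E\<close>, which will be the least
  stable relation containing the given pair, and the edges of the first \<open>h\<close> entries of the queue are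
  mapped into classes by all generators.\<close>

definition grows :: "(nat \<times> nat) set \<Rightarrow> state \<Rightarrow> (nat \<Rightarrow> nat) \<Rightarrow> bool" where
  "grows E s f \<longleftrightarrow> forest_in n s f \<and> same_value {..<n} f \<subseteq> E \<and>
     regs s ''h'' \<le> regs s ''m'' \<and>
     (\<forall>l<regs s ''h''. \<forall>k<ns. f (gens k (tabs s ''queue'' 0 l)) =
        f (gens k (tabs s ''par'' 0 (tabs s ''queue'' 0 l))))"

lemma queue_point:
  assumes "forest_in n s f" "l < regs s ''m''"
  shows "tabs s ''queue'' 0 l < n"
    "tabs s ''par'' 0 (tabs s ''queue'' 0 l) \<noteq> tabs s ''queue'' 0 l"
    "tabs s ''par'' 0 (tabs s ''queue'' 0 l) < n"
proof -
  have "tabs s ''queue'' 0 l \<in> tabs s ''queue'' 0 ` {..<regs s ''m''}" using assms(2) by simp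
  then show 1: "tabs s ''queue'' 0 l < n"
    "tabs s ''par'' 0 (tabs s ''queue'' 0 l) \<noteq> tabs s ''queue'' 0 l"
    unfolding forest_queue(1)[OF assms(1)] by auto
  show "tabs s ''par'' 0 (tabs s ''queue'' 0 l) < n" by (rule forestD(2)[OF assms(1) 1(1)])
qed

text \<open>A union only makes the relation coarser, and the entries of the queue keep their edges, so the
  work done on earlier entries is not lost.\<close>

lemma grows_step:
  assumes g: "grows E s f" and ext: "extends n s s'" and F: "forest_in n s' f'"
    and m: "merged n f a b f'" and E: "equiv {..<n} E" "(a, b) \<in> E"
  shows "grows E s' f'"
proof -
  note g' = g[unfolded grows_def]
  have F0: "forest_in n s f" using g' by blast
  have h: "regs s' ''h'' = regs s ''h''" "regs s ''m'' \<le> regs s' ''m''"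
    using ext unfolding extends_def agree_def by auto
  have "f' (gens k (tabs s' ''queue'' 0 l)) = f' (gens k (tabs s' ''par'' 0 (tabs s' ''queue'' 0 l)))"
    if "l < regs s ''h''" "k < ns" for l k
  proof -
    have l: "l < regs s ''m''" using that g' by auto
    note q = queue_point[OF F0 l]
    have "tabs s' ''queue'' 0 l = tabs s ''queue'' 0 l"
      "tabs s' ''par'' 0 (tabs s ''queue'' 0 l) = tabs s ''par'' 0 (tabs s ''queue'' 0 l)"
      using ext l q unfolding extends_def by auto
    then show ?thesis using merged_mono[OF m] gens that q g' by auto
  qed
  moreover have "same_value {..<n} f' \<subseteq> E"
    by (rule merged_within[OF E(1) _ m E(2)]) (use g' in blast)
  ultimately show ?thesis using h g' F unfolding grows_def by auto
qed

lemma runs_close_edge: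
  assumes ld: "loaded s" and g: "grows E s f" and E: "stable_equiv {..<n} moves E"
    and h: "regs s ''h'' < regs s ''m''" and c: "regs s ''c'' = tabs s ''queue'' 0 (regs s ''h'')"
    and k: "regs s ''k'' = 0" and ab: "f a = f b" "a < n" "b < n" and T: "ns * (4 * K + 16) + 1 \<le> T"
  shows "runs close_edge s T (\<lambda>s'. agree {''x'', ''y'', ''t'', ''m'', ''k''} {''par'', ''rank'', ''queue''} s s' \<and>
     (\<exists>f'. grows E s' f' \<and> f' a = f' b \<and> regs s ''h'' < regs s' ''m'' \<and>
       (\<forall>k<ns. f' (gens k (tabs s' ''queue'' 0 (regs s ''h''))) =
          f' (gens k (tabs s' ''par'' 0 (tabs s' ''queue'' 0 (regs s ''h'')))))))"
    (is "runs _ _ _ ?Q")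
proof -
  let ?h = "regs s ''h''"
  let ?c = "tabs s ''queue'' 0 ?h"
  let ?d = "tabs s ''par'' 0 ?c"
  let ?A = "agree {''x'', ''y'', ''t'', ''m'', ''k''} {''par'', ''rank'', ''queue''} s"
  let ?I = "\<lambda>s'. ?A s' \<and> regs s' ''k'' \<le> ns \<and> (\<exists>f'. grows E s' f' \<and> f' a = f' b \<and>
      ?h < regs s' ''m'' \<and> tabs s' ''queue'' 0 ?h = ?c \<and> tabs s' ''par'' 0 ?c = ?d \<and>
      (\<forall>k<regs s' ''k''. f' (gens k ?c) = f' (gens k ?d)))"
  show ?thesis unfolding close_edge_def
  proof (rule runs_While[where I = ?I and B = "4 * K + 15" and \<mu> = "\<lambda>s. ns - regs s ''k''"])
    show "?I s" using g ab h k by (auto simp: agree_refl)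
    show "(ns - regs s ''k'') * Suc (4 * K + 15) + 1 \<le> T" using T k by (simp add: add.commute)
    have F: "forest_in n s f" and fE: "same_value {..<n} f \<subseteq> E" using g unfolding grows_def by auto
    note q = queue_point[OF F h]
    have "f ?c = f ?d" using forestD(4)[OF F q(1)] by simp
    then have cd: "(?c, ?d) \<in> E" using fE q by auto
    have eq: "equiv {..<n} E" using E unfolding stable_equiv_def by blast
    fix s' assume I: "?I s'"
    then obtain f' where f': "grows E s' f'" "f' a = f' b" "?h < regs s' ''m''"
        "tabs s' ''queue'' 0 ?h = ?c" "tabs s' ''par'' 0 ?c = ?d"
        "\<forall>k<regs s' ''k''. f' (gens k ?c) = f' (gens k ?d)" and A: "?A s'" and kn: "regs s' ''k'' \<le> ns" by blast
    have ld': "loaded s'" by (rule loaded_agree[OF ld A]) auto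
    have c': "regs s' ''c'' = ?c" using agreeD(1)[OF A, of "''c''"] c by simp
    {
      assume "test_val (Less (Reg ''k'') (Reg ''s'')) s'"
      then have k': "regs s' ''k'' < ns" using ld' unfolding loaded_def by simp
      let ?k = "regs s' ''k''"
      let ?s = "set_reg ''y'' (gens ?k ?d) (set_reg ''x'' (gens ?k ?c) s')"
      have g1: "grows E ?s f'" using f'(1) unfolding grows_def by simp
      then have F1: "forest_in n ?s f'" unfolding grows_def by blast
      have xy: "gens ?k ?c < n" "gens ?k ?d < n" using gens k' q by auto
      have xyE: "(gens ?k ?c, gens ?k ?d) \<in> E"
        using E cd k' unfolding stable_equiv_def moves_def by auto
      have A1: "?A ?s" using A by (auto intro!: agree_intros)
      have "runs (Seq unite (Assign ''k'' (Inc (Reg ''k'')))) ?s (4 * K + 13)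
        (\<lambda>s''. ?I s'' \<and> ns - regs s'' ''k'' < ns - regs s' ''k'')" (is "runs _ _ _ ?R")
      proof (rule runs_Seq[where T = "4 * K + 12" and U = 1])
        have "runs unite ?s (4 * K + 12) (\<lambda>s''. (\<exists>f''. forest_in n s'' f'' \<and>
           merged n f' (gens ?k ?c) (gens ?k ?d) f'') \<and> extends n ?s s'')"
          by (rule runs_unite[OF F1 K]) (use xy in auto)
        then show "runs unite ?s (4 * K + 12) (\<lambda>s''. runs (Assign ''k'' (Inc (Reg ''k''))) s'' 1 ?R)"
        proof (rule runs_weaken, goal_cases)
          case (2 s'')
          then obtain f'' where f'': "forest_in n s'' f''"
            "merged n f' (gens ?k ?c) (gens ?k ?d) f''" and ext: "extends n ?s s''" by blast
          have g2: "grows E s'' f''" by (rule grows_step[OF g1 ext f'' eq xyE])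
          have A2: "agree {''x'', ''y'', ''t'', ''m''} {''par'', ''rank'', ''queue''} ?s s''"
            using ext unfolding extends_def by blast
          then have A3: "?A s''" by (rule agree_trans[OF A1]) auto
          have k2: "regs s'' ''k'' = ?k" using agreeD(1)[OF A2, of "''k''"] by simp
          have "tabs s'' ''queue'' 0 ?h = ?c" "tabs s'' ''par'' 0 ?c = ?d" "?h < regs s'' ''m''"
            using ext f' q unfolding extends_def by auto
          moreover have "f'' (gens k ?c) = f'' (gens k ?d)" if "k < Suc ?k" for k
          proof (cases "k = ?k")
            case True
            then show ?thesis using merged_joins[OF f''(2) xy] by simp
          next
            case False
            then have "f' (gens k ?c) = f' (gens k ?d)" "k < ns" using that f'(6) k' by auto
            then show ?thesis using merged_mono[OF f''(2)] gens q by blast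
          qed
          moreover have "f'' a = f'' b" using merged_mono[OF f''(2)] ab f'(2) by blast
          moreover have "grows E (set_reg ''k'' (Suc ?k) s'') f''" using g2 unfolding grows_def by simp
          ultimately show ?case
            using A3 k' k2 by (intro runs_simple) (auto intro!: agree_intros exI[of _ f''])
        qed auto
      qed auto
      moreover have "tabs s' ''gens'' = gens" using ld' unfolding loaded_def by simp
      ultimately show "runs (Seq (Assign ''x'' (Read ''gens'' (Reg ''k'') (Reg ''c'')))
        (Seq (Assign ''y'' (Read ''gens'' (Reg ''k'') (par (Reg ''c''))))
        (Seq unite (Assign ''k'' (Inc (Reg ''k'')))))) s' (4 * K + 15) ?R"
        using c' f'(4,5) by (intro runs_simple) (simp_all add: add.commute)
    next
      assume "\<not> test_val (Less (Reg ''k'') (Reg ''s'')) s'"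
      then have "regs s' ''k'' = ns" using ld' kn unfolding loaded_def by simp
      then show "?Q s'" using A f' by auto
    }
  qed
qed

lemma runs_saturate:
  assumes ld: "loaded s" and g: "grows E s f" and E: "stable_equiv {..<n} moves E"
    and h: "regs s ''h'' = 0" and ab: "f a = f b" "a < n" "b < n"
    and T: "n * (ns * (4 * K + 16) + 5) + 1 \<le> T"
  shows "runs saturate s T (\<lambda>s'. agree {''x'', ''y'', ''t'', ''m'', ''k'', ''c'', ''h''} {''par'', ''rank'', ''queue''} s s' \<and>
     (\<exists>f'. forest_in n s' f' \<and> same_value {..<n} f' \<subseteq> E \<and> f' a = f' b \<and>
        stable_equiv {..<n} moves (same_value {..<n} f')))"
    (is "runs _ _ _ ?Q")
proof -
  let ?A = "agree {''x'', ''y'', ''t'', ''m'', ''k'', ''c'', ''h''} {''par'', ''rank'', ''queue''} s"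
  let ?I = "\<lambda>s'. ?A s' \<and> (\<exists>f'. grows E s' f' \<and> f' a = f' b)"
  show ?thesis unfolding saturate_def
  proof (rule runs_While[where I = ?I and B = "ns * (4 * K + 16) + 4" and \<mu> = "\<lambda>s. n - regs s ''h''"])
    show "?I s" using g ab by (auto simp: agree_refl)
    show "(n - regs s ''h'') * Suc (ns * (4 * K + 16) + 4) + 1 \<le> T" using T h by (simp add: add.commute)
    fix s' assume "?I s'"
    then obtain f' where f': "grows E s' f'" "f' a = f' b" and A: "?A s'" by blast
    have F: "forest_in n s' f'" using f' unfolding grows_def by blast
    have ld': "loaded s'" by (rule loaded_agree[OF ld A]) auto
    {
      assume "test_val (Less (Reg ''h'') (Reg ''m'')) s'"
      then have h': "regs s' ''h'' < regs s' ''m''" by simp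
      let ?h = "regs s' ''h''"
      have hn: "?h < n" using h' forest_roots_card[OF F] by linarith
      let ?s = "set_reg ''k'' 0 (set_reg ''c'' (tabs s' ''queue'' 0 ?h) s')"
      have g1: "grows E ?s f'" using f'(1) unfolding grows_def by simp
      have A1: "?A ?s" using A by (auto intro!: agree_intros)
      have ld1: "loaded ?s" by (rule loaded_agree[OF ld A1]) auto
      show "runs (Seq (Assign ''c'' (queue (Reg ''h''))) (Seq (Assign ''k'' (Const 0))
        (Seq close_edge (Assign ''h'' (Inc (Reg ''h'')))))) s' (ns * (4 * K + 16) + 4)
        (\<lambda>s''. ?I s'' \<and> n - regs s'' ''h'' < n - regs s' ''h'')"
      proof (intro runs_simple, simp, simp,
          rule runs_Seq[where T = "ns * (4 * K + 16) + 1" and U = 1], simp,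
          rule runs_weaken[OF runs_close_edge[OF ld1 g1 E _ _ _ f'(2) ab(2,3) order_refl]], goal_cases)
        case (5 s'')
        then obtain f'' where
          A2: "agree {''x'', ''y'', ''t'', ''m'', ''k''} {''par'', ''rank'', ''queue''} ?s s''"
          and f'': "grows E s'' f''" "f'' a = f'' b" "?h < regs s'' ''m''"
            "\<forall>k<ns. f'' (gens k (tabs s'' ''queue'' 0 ?h)) =
               f'' (gens k (tabs s'' ''par'' 0 (tabs s'' ''queue'' 0 ?h)))"
          by auto
        have A3: "?A s''" using A2 by (rule agree_trans[OF A1]) auto
        have h2: "regs s'' ''h'' = ?h" using agreeD(1)[OF A2, of "''h''"] by simp
        have "grows E (set_reg ''h'' (Suc ?h) s'') f''"
          using f'' h2 unfolding grows_def by (auto simp: less_Suc_eq)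
        then show ?case
          using A3 f'' h2 hn by (intro runs_simple) (auto intro!: agree_intros)
      qed (use h' in auto)
    next
      assume "\<not> test_val (Less (Reg ''h'') (Reg ''m'')) s'"
      then have hm: "regs s' ''h'' = regs s' ''m''" using f' unfolding grows_def by simp
      have "stable_equiv {..<n} moves (same_value {..<n} f')"
      proof (rule forest_stable[OF F])
        show "g x < n" if "g \<in> moves" "x < n" for g x using that gens unfolding moves_def by auto
        show "f' (g (tabs s' ''queue'' 0 k)) = f' (g (tabs s' ''par'' 0 (tabs s' ''queue'' 0 k)))"
          if "k < regs s' ''m''" "g \<in> moves" for k g
          using that f' hm unfolding grows_def moves_def by auto
      qed
      then show "?Q s'" using A f' F unfolding grows_def by blast
    }
  qed
qed

abbreviation all_pairs :: "(nat \<times> nat) set" where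
  "all_pairs \<equiv> {..<n} \<times> {..<n}"

definition pair_equiv :: "nat \<Rightarrow> (nat \<times> nat) set" where
  "pair_equiv i = generated_equiv {..<n} moves (base 0 i) (cert i (base 0 i))"

lemma pair_equiv_props:
  assumes "i \<le> L"
  shows "stable_equiv {..<n} moves (pair_equiv i)" "(base 0 i, cert i (base 0 i)) \<in> pair_equiv i"
  unfolding pair_equiv_def
  by (rule stable_equiv_generated; use assms base cert gens in \<open>auto simp: moves_def\<close>)+

lemma runs_initialize:
  assumes ld: "loaded s" and j: "regs s ''j'' = 0" and T: "n * 4 + 1 \<le> T"
  shows "runs initialize s T (\<lambda>s'. agree {''j''} {''par'', ''rank''} s s' \<and>
     (\<forall>x<n. tabs s' ''par'' 0 x = x \<and> tabs s' ''rank'' 0 x = 0))"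
  unfolding initialize_def
proof (rule runs_While[where B = 3 and \<mu> = "\<lambda>s. n - regs s ''j''" and
      I = "\<lambda>s'. agree {''j''} {''par'', ''rank''} s s' \<and>
     (\<forall>x<regs s' ''j''. tabs s' ''par'' 0 x = x \<and> tabs s' ''rank'' 0 x = 0)"], goal_cases)
  case 1
  then show ?case using j by (simp add: agree_refl)
next
  case (2 s')
  then have "loaded s'" by (auto intro: loaded_agree[OF ld])
  then show ?case using 2
    by (intro runs_simple) (auto simp: loaded_def less_Suc_eq intro!: agree_intros)
next
  case 3
  then show ?case using T j by simp
next
  case (4 s')
  then have "loaded s'" by (auto intro: loaded_agree[OF ld])
  then show ?case using 4 by (auto simp: loaded_def)
qed

text \<open>The final relation is contained in \<open>pair_equiv i\<close> by the invariant. It is stable and contains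
  the pair, so minimality gives the other inclusion.\<close>

lemma runs_attempt:
  assumes ld: "loaded s" and i: "regs s ''i'' = i" "i \<le> L" and d: "regs s ''d'' = 0"
    and T: "n * (ns * (4 * K + 16) + 9) + 4 * K + 22 \<le> T"
  shows "runs attempt s T (\<lambda>s'. loaded s' \<and> regs s' ''i'' = Suc i \<and>
     regs s' ''d'' = (if pair_equiv i = all_pairs then 0 else 1) \<and>
     (\<exists>f. forest_in n s' f \<and> same_value {..<n} f = pair_equiv i))"
    (is "runs _ _ _ ?Q")
  unfolding attempt_def
proof (intro runs_simple, goal_cases)
  case 2
  let ?s0 = "set_reg ''j'' 0 s"
  let ?a = "base 0 i"
  let ?b = "cert i ?a"
  let ?U = "n * (ns * (4 * K + 16) + 5) + 1"
  let ?X = "{''x'', ''y'', ''t'', ''m'', ''k'', ''c'', ''h'', ''j''}"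
  let ?Y = "{''par'', ''rank'', ''queue''}"
  have ab: "?a < n" "?b < n" using base cert i by auto
  have A0: "agree ?X ?Y s ?s0" by (auto intro!: agree_intros)
  have ld0: "loaded ?s0" using ld by (simp add: loaded_def)
  have E: "stable_equiv {..<n} moves (pair_equiv i)" "(?a, ?b) \<in> pair_equiv i" using pair_equiv_props i by auto
  then have eq: "equiv {..<n} (pair_equiv i)" unfolding stable_equiv_def by blast
  have "runs (Seq initialize
    (Seq (Assign ''h'' (Const 0)) (Seq (Assign ''m'' (Const 0))
    (Seq (Assign ''x'' (Read ''base'' (Const 0) (Reg ''i'')))
    (Seq (Assign ''y'' (Read ''cert'' (Reg ''i'') (Reg ''x'')))
    (Seq unite (Seq saturate
    (Seq (If (Less (Inc (Reg ''m'')) (Reg ''n'')) (Assign ''d'' (Const 1)) Skip)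
      (Assign ''i'' (Inc (Reg ''i''))))))))))) ?s0 (T - 1) ?Q"
  proof (rule runs_Seq[where T = "n * 4 + 1" and U = "?U + 4 * K + 19"],
      rule runs_weaken[OF runs_initialize[OF ld0 _ order_refl]], goal_cases)
    case (3 s1)
    then have A1: "agree ?X ?Y s s1" using agree_trans[OF A0] by auto
    let ?s = "set_reg ''y'' ?b (set_reg ''x'' ?a (set_reg ''m'' 0 (set_reg ''h'' 0 s1)))"
    have A2: "agree ?X ?Y s ?s" using A1 by (auto intro!: agree_intros)
    have ld2: "loaded ?s" by (rule loaded_agree[OF ld A2]) auto
    have F2: "forest_in n ?s (\<lambda>x. x)" using 3 forest_init[of n "tabs s1 ''par'' 0" "tabs s1 ''rank'' 0"] by simp
    have "same_value {..<n} (\<lambda>x. x) \<subseteq> pair_equiv i"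
      using eq by (auto simp: same_value_def equiv_def refl_on_def)
    then have g2: "grows (pair_equiv i) ?s (\<lambda>x. x)" using F2 unfolding grows_def by simp
    have i2: "regs ?s ''i'' = i" using A2 i agreeD(1)[OF A2, of "''i''"] by simp
    show ?case
    proof (intro runs_simple, goal_cases)
      case 5
      have "runs (Seq unite (Seq saturate
        (Seq (If (Less (Inc (Reg ''m'')) (Reg ''n'')) (Assign ''d'' (Const 1)) Skip)
        (Assign ''i'' (Inc (Reg ''i'')))))) ?s (?U + 4 * K + 15) ?Q"
      proof (rule runs_Seq[where T = "4 * K + 12" and U = "?U + 3"],
          rule runs_weaken[OF runs_unite[OF F2 K _ ab(1) _ ab(2) order_refl]], goal_cases)
        case (4 s3)
        then obtain f where F3: "forest_in n s3 f" and m: "merged n (\<lambda>x. x) ?a ?b f"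
          and ext: "extends n ?s s3" by blast
        have g3: "grows (pair_equiv i) s3 f" by (rule grows_step[OF g2 ext F3 m eq E(2)])
        have fab: "f ?a = f ?b" by (rule merged_joins[OF m ab])
        have A3': "agree {''x'', ''y'', ''t'', ''m''} ?Y ?s s3" using ext unfolding extends_def by blast
        then have A3: "agree ?X ?Y s s3" by (rule agree_trans[OF A2]) auto
        have ld3: "loaded s3" by (rule loaded_agree[OF ld A3]) auto
        have h3: "regs s3 ''h'' = 0" using agreeD(1)[OF A3', of "''h''"] by simp
        show ?case
        proof (rule runs_Seq[where T = "?U" and U = 3],
          rule runs_weaken[OF runs_saturate[OF ld3 g3 E(1) h3 fab ab order_refl]], goal_cases)
          case (2 s4)
          then obtain f' where
            A4': "agree {''x'', ''y'', ''t'', ''m'', ''k'', ''c'', ''h''} ?Y s3 s4"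
            and f': "forest_in n s4 f'" "same_value {..<n} f' \<subseteq> pair_equiv i" "f' ?a = f' ?b"
              "stable_equiv {..<n} moves (same_value {..<n} f')" by blast
          have A4: "agree ?X ?Y s s4" by (rule agree_trans[OF A3 A4']) auto
          have ld4: "loaded s4" by (rule loaded_agree[OF ld A4]) auto
          have i4: "regs s4 ''i'' = i" "regs s4 ''d'' = 0"
            using agreeD(1)[OF A4, of "''i''"] agreeD(1)[OF A4, of "''d''"] i d by auto
          have "pair_equiv i \<subseteq> same_value {..<n} f'"
            unfolding pair_equiv_def using f' ab by (intro generated_equiv_least) auto
          then have c: "same_value {..<n} f' = pair_equiv i" using f' by blast
          have tot: "pair_equiv i = all_pairs \<longleftrightarrow> n \<le> Suc (regs s4 ''m'')"
            using forest_total[OF f'(1) n_pos] c by simp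
          show ?case
          proof (rule runs_Seq[where T = 2 and U = 1], rule runs_If[where T = 1], goal_cases)
            case 1
            then have "pair_equiv i \<noteq> all_pairs" using tot ld4 by (simp add: loaded_def)
            then show ?case using f' c i4 ld4
              by (intro runs_simple conjI exI[of _ f']) (auto simp: loaded_def)
          next
            case 2
            then have "pair_equiv i = all_pairs" using tot ld4 by (simp add: loaded_def)
            then show ?case using f' c i4 ld4
              by (intro runs_simple conjI exI[of _ f']) (auto simp: loaded_def)
          qed auto
        qed auto
      qed auto
      moreover have "tabs s1 ''base'' = base" "tabs s1 ''cert'' = cert" "regs s1 ''i'' = i"
        using ld2 i2 unfolding loaded_def by auto
      ultimately show ?case by (auto elim: runs_weaken)
    qed auto
  qed (use T in \<open>auto simp: algebra_simps\<close>)
  then show ?case by simp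
qed (use T in auto)

definition attempt_time :: nat where
  "attempt_time = n * (ns * (4 * K + 16) + 9) + 4 * K + 22"

text \<open>The hypothesis that some relation has more than one class excludes the exit of the loop with
  \<open>i = L + 1\<close> and \<open>d = 0\<close>.\<close>

lemma runs_search:
  assumes ld: "loaded s" and i: "regs s ''i'' = 0" and d: "regs s ''d'' = 0"
    and ex: "\<exists>i\<le>L. pair_equiv i \<noteq> all_pairs" and T: "Suc L * Suc attempt_time + 1 \<le> T"
  shows "runs search s T (\<lambda>s'. loaded s' \<and>
     (\<exists>i\<le>L. pair_equiv i \<noteq> all_pairs \<and> (\<exists>f. forest_in n s' f \<and> same_value {..<n} f = pair_equiv i)))"
    (is "runs _ _ _ ?Q")
proof -
  let ?I = "\<lambda>s'. loaded s' \<and> regs s' ''i'' \<le> Suc L \<and>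
    (if regs s' ''d'' = 0 then \<forall>i<regs s' ''i''. pair_equiv i = all_pairs
     else \<exists>i\<le>L. pair_equiv i \<noteq> all_pairs \<and> (\<exists>f. forest_in n s' f \<and> same_value {..<n} f = pair_equiv i))"
  show ?thesis unfolding search_def
  proof (rule runs_While[where I = ?I and B = attempt_time and \<mu> = "\<lambda>s. Suc L - regs s ''i''"])
    show "?I s" using assms by simp
    show "(Suc L - regs s ''i'') * Suc attempt_time + 1 \<le> T" using T i by simp
    fix s' assume I: "?I s'"
    let ?b = "Conj (Less (Reg ''i'') (Inc (Reg ''L''))) (Equal (Reg ''d'') (Const 0))"
    {
      assume "test_val ?b s'"
      then have id: "regs s' ''i'' \<le> L" "regs s' ''d'' = 0" using I by (auto simp: loaded_def)
      show "runs attempt s' attempt_time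
        (\<lambda>s''. ?I s'' \<and> Suc L - regs s'' ''i'' < Suc L - regs s' ''i'')"
      proof (rule runs_weaken[OF runs_attempt[OF _ refl id order_refl]], goal_cases)
        case (3 s'')
        then show ?case using I id by (auto simp: less_Suc_eq split: if_splits)
      qed (use I in \<open>auto simp: attempt_time_def\<close>)
    next
      assume "\<not> test_val ?b s'"
      then have "regs s' ''d'' = 0 \<Longrightarrow> Suc L \<le> regs s' ''i''" using I by (auto simp: loaded_def)
      then have "regs s' ''d'' \<noteq> 0" using I ex by (auto simp: less_Suc_eq_le)
      then show "?Q s'" using I by simp
    }
  qed
qed

lemma runs_label:
  assumes ld: "loaded s" and F: "forest_in n s f" and j: "regs s ''j'' = 0"
    and T: "n * (2 * K + 5) + 1 \<le> T"
  shows "runs label s T (\<lambda>s'. \<forall>x<n. tabs s' ''cell'' 0 x = f x)"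
proof -
  let ?A = "agree {''x'', ''j''} {''cell''} s"
  let ?I = "\<lambda>s'. ?A s' \<and> (\<forall>x<regs s' ''j''. tabs s' ''cell'' 0 x = f x)"
  show ?thesis unfolding label_def
  proof (rule runs_While[where I = ?I and B = "2 * K + 4" and \<mu> = "\<lambda>s. n - regs s ''j''"])
    show "?I s" using j by (simp add: agree_refl)
    show "(n - regs s ''j'') * Suc (2 * K + 4) + 1 \<le> T" using T j by (simp add: add.commute)
    fix s' assume I: "?I s'"
    then have ld': "loaded s'" by (auto intro: loaded_agree[OF ld])
    {
      assume "test_val (Less (Reg ''j'') (Reg ''n'')) s'"
      then have j': "regs s' ''j'' < n" using ld' by (simp add: loaded_def)
      have F': "forest n (tabs (set_reg ''x'' w s') ''par'' 0) (tabs s ''rank'' 0)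
        (tabs s ''queue'' 0) (regs s ''m'') f" for w
        using F I agreeD(2)[of _ _ s s' "''par''"] by fastforce
      show "runs (Seq (Assign ''x'' (Reg ''j'')) (Seq (find_root ''x'')
        (Seq (Write ''cell'' (Const 0) (Reg ''j'') (Reg ''x'')) (Assign ''j'' (Inc (Reg ''j''))))))
        s' (2 * K + 4) (\<lambda>s''. ?I s'' \<and> n - regs s'' ''j'' < n - regs s' ''j'')"
      proof (intro runs_simple, simp, rule runs_Seq[where T = "2 * K + 1" and U = 2],
          rule runs_find_root[OF F' K], goal_cases)
        case 3
        then show ?case using I j'
          by (intro runs_simple) (auto simp: less_Suc_eq intro!: agree_intros)
      qed (use j' in auto)
    next
      assume "\<not> test_val (Less (Reg ''j'') (Reg ''n'')) s'"
      then show "\<forall>x<n. tabs s' ''cell'' 0 x = f x" using I ld' by (auto simp: loaded_def)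
    }
  qed
qed

lemma runs_find_blocks:
  assumes ld: "loaded s" and i: "regs s ''i'' = 0" and d: "regs s ''d'' = 0"
    and ex: "\<exists>i\<le>L. pair_equiv i \<noteq> all_pairs"
    and T: "Suc L * Suc attempt_time + n * (2 * K + 5) + 3 \<le> T"
  shows "runs find_blocks s T (\<lambda>s'. \<exists>i\<le>L. pair_equiv i \<noteq> all_pairs \<and>
     same_value {..<n} (tabs s' ''cell'' 0) = pair_equiv i)"
  unfolding find_blocks_def
proof (rule runs_Seq[where T = "Suc L * Suc attempt_time + 1" and U = "n * (2 * K + 5) + 2"],
    rule runs_weaken[OF runs_search[OF ld i d ex order_refl]], goal_cases)
  case (2 s')
  then obtain i f where f: "loaded s'" "i \<le> L" "pair_equiv i \<noteq> all_pairs" "forest_in n s' f"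
    "same_value {..<n} f = pair_equiv i" by blast
  show ?case
  proof (intro runs_simple, simp, rule runs_weaken[OF runs_label[where f = f, OF _ _ _ order_refl]], goal_cases)
    case (5 s'')
    then have "same_value {..<n} (tabs s'' ''cell'' 0) = same_value {..<n} f"
      by (auto simp: same_value_def)
    then show ?case using f by blast
  qed (use f in \<open>auto simp: loaded_def\<close>)
qed (use T in auto)

end

section \<open>Block systems\<close>

lemma nonredundant_distinct:
  assumes "nonredundant H cs"
  shows "distinct cs"
proof -
  have "cs ! j \<noteq> cs ! i" if "j < i" "i < length cs" for i j
    using assms that unfolding nonredundant_def by metis
  then show ?thesis unfolding distinct_conv_nth by (metis linorder_neqE_nat)
qed

lemma nonredundant_snoc:
  assumes "nonredundant H cs" "h \<in> H" "\<And>c. c \<in> set cs \<Longrightarrow> h c = c" "h b \<noteq> b"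
  shows "nonredundant H (cs @ [b])"
  unfolding nonredundant_def
proof (intro allI impI)
  fix i assume i: "i < length (cs @ [b])"
  show "\<exists>g\<in>H. (\<forall>j<i. g ((cs @ [b]) ! j) = (cs @ [b]) ! j) \<and> g ((cs @ [b]) ! i) \<noteq> (cs @ [b]) ! i"
  proof (cases "i < length cs")
    case True
    then show ?thesis using assms(1) unfolding nonredundant_def
      by (auto simp: nth_append)
  next
    case False
    then have "i = length cs" using i by simp
    then show ?thesis using assms(2-4) by (intro bexI[of _ h]) (auto simp: nth_append)
  qed
qed

text \<open>As long as the list is not a base, some element of \<open>H\<close> fixes the list pointwise and moves a
  further point, which can be appended. This stops because nonredundant lists have no repetitions.
  Extensionality of the elements of \<open>H\<close> ensures that an element other than the identity does move
  a point of \<open>A\<close>.\<close>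

lemma nonredundant_extend:
  assumes A: "finite A" and H: "H \<subseteq> extensional A" "\<one>\<^bsub>BijGroup A\<^esub> \<in> H"
    and cs: "nonredundant H cs" "set cs \<subseteq> A"
  shows "\<exists>ds. nonredundant_base A H (cs @ ds)"
  using cs
proof (induction "card A - length cs" arbitrary: cs rule: less_induct)
  case less
  show ?case
  proof (cases "is_base A H cs")
    case True
    then show ?thesis using less.prems by (intro exI[of _ "[]"]) (simp add: nonredundant_base_def)
  next
    case False
    have one: "\<one>\<^bsub>BijGroup A\<^esub> = (\<lambda>x\<in>A. x)" by (simp add: BijGroup_def)
    have "\<one>\<^bsub>BijGroup A\<^esub> \<in> {g \<in> H. \<forall>b\<in>set cs. g b = b}"
      using H(2) less.prems(2) by (auto simp: one)
    then obtain h where h: "h \<in> H" "\<And>b. b \<in> set cs \<Longrightarrow> h b = b" "h \<noteq> \<one>\<^bsub>BijGroup A\<^esub>"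
      using False less.prems(2) unfolding is_base_def by blast
    obtain b where b: "b \<in> A" "h b \<noteq> b"
    proof (rule ccontr)
      assume "\<not> thesis"
      then have "\<And>x. x \<in> A \<Longrightarrow> h x = x" using that by blast
      then have "h = (\<lambda>x\<in>A. x)"
        using H(1) h(1) by (intro extensionalityI[of _ A]) auto
      then show False using h(3) one by simp
    qed
    have nr: "nonredundant H (cs @ [b])" by (rule nonredundant_snoc[OF less.prems(1) h(1,2) b(2)])
    have sub: "set (cs @ [b]) \<subseteq> A" using less.prems(2) b(1) by simp
    have "length (cs @ [b]) = card (set (cs @ [b]))"
      using nonredundant_distinct[OF nr] distinct_card by metis
    also have "\<dots> \<le> card A" by (rule card_mono[OF A sub])
    finally have "card A - length (cs @ [b]) < card A - length cs" by simp
    from less.hyps[OF this nr sub] show ?thesis by auto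
  qed
qed

text \<open>If the conclusion failed, the permutations of the blocks induced by \<open>gs\<close> would certify the list
  of the blocks of the \<open>bs ! i\<close> to be nonredundant, and it would extend to a nonredundant base with more
  than \<open>L\<close> points.\<close>

lemma exists_certificate_in_block:
  assumes fin: "finite \<Omega>" and G: "\<one>\<^bsub>BijGroup \<Omega>\<^esub> \<in> G" and \<Sigma>: "block_system \<Omega> G \<Sigma>"
    and short: "\<And>cs. nonredundant_base \<Sigma> (block_action G \<Sigma>) cs \<Longrightarrow> length cs \<le> L"
    and cert: "certified_partial_base \<Omega> G bs gs" and len: "length bs = L + 1"
  shows "\<exists>i\<le>L. \<exists>B\<in>\<Sigma>. bs ! i \<in> B \<and> (gs ! i) (bs ! i) \<in> B"
proof (rule ccontr)
  assume no: "\<not> ?thesis"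
  have P: "partition_on \<Omega> \<Sigma>" and inv: "\<And>g B. g \<in> G \<Longrightarrow> B \<in> \<Sigma> \<Longrightarrow> g ` B \<in> \<Sigma>"
    using \<Sigma> unfolding block_system_def by auto
  have sub: "\<And>B. B \<in> \<Sigma> \<Longrightarrow> B \<subseteq> \<Omega>" using P by (auto simp: partition_on_def)
  have same: "B = C" if "B \<in> \<Sigma>" "C \<in> \<Sigma>" "x \<in> B" "x \<in> C" for B C x
    using P that by (auto simp: partition_on_def disjoint_def)
  have "\<forall>x\<in>\<Omega>. \<exists>B. B \<in> \<Sigma> \<and> x \<in> B" using P by (auto simp: partition_on_def)
  then obtain blk where blk: "\<And>x. x \<in> \<Omega> \<Longrightarrow> blk x \<in> \<Sigma>" "\<And>x. x \<in> \<Omega> \<Longrightarrow> x \<in> blk x"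
    by metis
  have bs: "bs ! i \<in> \<Omega>" if "i \<le> L" for i
    using cert len that unfolding certified_partial_base_def by (auto dest!: nth_mem)
  have gs: "gs ! i \<in> G" "j < i \<Longrightarrow> (gs ! i) (bs ! j) = bs ! j" if "i \<le> L" for i j
    using cert len that unfolding certified_partial_base_def certifies_def by auto
  let ?H = "block_action G \<Sigma>" and ?cs = "map blk bs"
  have "nonredundant ?H ?cs" unfolding nonredundant_def
  proof (intro allI impI)
    fix i assume "i < length ?cs"
    then have i: "i \<le> L" using len by simp
    let ?g = "gs ! i"
    let ?h = "\<lambda>B\<in>\<Sigma>. ?g ` B"
    have "?h \<in> ?H" using gs(1)[OF i] by (auto simp: block_action_def)
    moreover have "?h (?cs ! j) = ?cs ! j" if "j < i" for j
    proof -
      have b: "bs ! j \<in> \<Omega>" using bs i that by simp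
      have "?g ` blk (bs ! j) = blk (bs ! j)"
        using gs[OF i] that blk[OF b] inv by (intro same[of _ _ "bs ! j"]) (auto simp: image_iff intro!: bexI[of _ "bs ! j"])
      then show ?thesis using that i len blk[OF b] by simp
    qed
    moreover have "?h (?cs ! i) \<noteq> ?cs ! i"
    proof
      assume "?h (?cs ! i) = ?cs ! i"
      then have "?g ` blk (bs ! i) = blk (bs ! i)" using i len blk[OF bs[OF i]] by simp
      then have "?g (bs ! i) \<in> blk (bs ! i)" using blk(2)[OF bs[OF i]] by blast
      then show False using no i blk[OF bs[OF i]] by blast
    qed
    ultimately show "\<exists>h\<in>?H. (\<forall>j<i. h (?cs ! j) = ?cs ! j) \<and> h (?cs ! i) \<noteq> ?cs ! i" by blast
  qed
  moreover have "finite \<Sigma>" using fin P by (rule finite_elements)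
  moreover have "?H \<subseteq> extensional \<Sigma>" by (auto simp: block_action_def)
  moreover have "\<one>\<^bsub>BijGroup \<Sigma>\<^esub> \<in> ?H"
  proof -
    have "\<one>\<^bsub>BijGroup \<Omega>\<^esub> ` B = B" if "B \<in> \<Sigma>" for B
      using sub[OF that] by (force simp: BijGroup_def)
    then have "\<one>\<^bsub>BijGroup \<Sigma>\<^esub> = (\<lambda>B\<in>\<Sigma>. \<one>\<^bsub>BijGroup \<Omega>\<^esub> ` B)"
      by (auto simp: BijGroup_def fun_eq_iff restrict_def)
    then show ?thesis using G by (auto simp: block_action_def)
  qed
  moreover have "set ?cs \<subseteq> \<Sigma>"
    using cert blk by (auto simp: certified_partial_base_def)
  ultimately obtain ds where "nonredundant_base \<Sigma> ?H (?cs @ ds)"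
    using nonredundant_extend by blast
  from short[OF this] show False using len by simp
qed

text \<open>An injective map of the finite set \<open>E\<close> of pairs into itself is onto, so a pair mapped into \<open>E\<close> comes
  from \<open>E\<close>. This is what makes inverses of generators harmless.\<close>

lemma stable_equiv_reflects:
  assumes fin: "finite A" and E: "stable_equiv A F E" and g: "g \<in> F" "inj_on g A"
    and xy: "x \<in> A" "y \<in> A" "(g x, g y) \<in> E"
  shows "(x, y) \<in> E"
proof -
  have sub: "E \<subseteq> A \<times> A" using E unfolding stable_equiv_def equiv_def by blast
  let ?g = "map_prod g g"
  have "?g ` E \<subseteq> E" using E g(1) unfolding stable_equiv_def by auto
  moreover have inj: "inj_on ?g (A \<times> A)" using g(2) by (auto simp: inj_on_def)
  moreover have "finite E" using sub fin by (meson finite_SigmaI finite_subset)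
  ultimately have "?g ` E = E"
    by (intro endo_inj_surj) (auto intro: inj_on_subset[OF _ sub])
  then obtain u where u: "u \<in> E" "?g (x, y) = ?g u" using xy(3) by (metis imageE map_prod_simp)
  then have "(x, y) = u" using inj sub xy by (intro inj_onD[OF inj u(2)]) auto
  then show ?thesis using u by simp
qed

text \<open>Stability under the generators is a statement about semigroups. With \<open>stable_equiv_reflects\<close> it
  becomes an equivalence, which passes to inverses and products and hence to the whole group.\<close>

lemma block_system_level_sets:
  assumes fin: "finite \<Omega>" and S: "S \<subseteq> carrier (BijGroup \<Omega>)"
    and stable: "stable_equiv \<Omega> S (same_value \<Omega> c)"
    and total: "same_value \<Omega> c \<noteq> \<Omega> \<times> \<Omega>"
    and xy: "x \<in> \<Omega>" "y \<in> \<Omega>" "x \<noteq> y" "c x = c y"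
  shows "block_system \<Omega> (generate (BijGroup \<Omega>) S) ((\<lambda>x. {y \<in> \<Omega>. c y = c x}) ` \<Omega>)"
    (is "block_system _ ?G ?\<Sigma>")
proof -
  interpret group "BijGroup \<Omega>" by (rule group_BijGroup)
  have carr: "carrier (BijGroup \<Omega>) = Bij \<Omega>" by (simp add: BijGroup_def)
  have bij: "bij_betw g \<Omega> \<Omega>" if "g \<in> carrier (BijGroup \<Omega>)" for g
    using that by (simp add: carr Bij_def)
  have Gc: "?G \<subseteq> carrier (BijGroup \<Omega>)" by (rule generate_incl[OF S])
  have Sp: "c u = c v \<longleftrightarrow> c (s u) = c (s v)" if "s \<in> S" "u \<in> \<Omega>" "v \<in> \<Omega>" for s u v
  proof
    assume "c u = c v"
    then show "c (s u) = c (s v)" using stable that unfolding stable_equiv_def by force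
  next
    assume eq: "c (s u) = c (s v)"
    have b: "bij_betw s \<Omega> \<Omega>" using bij S that by blast
    then have "s u \<in> \<Omega>" "s v \<in> \<Omega>" using that by (auto dest: bij_betwE)
    then have "(s u, s v) \<in> same_value \<Omega> c" using eq by simp
    then have "(u, v) \<in> same_value \<Omega> c"
      by (rule stable_equiv_reflects[OF fin stable that(1) bij_betw_imp_inj_on[OF b] that(2,3)])
    then show "c u = c v" by simp
  qed
  have Gp: "\<forall>u\<in>\<Omega>. \<forall>v\<in>\<Omega>. c u = c v \<longleftrightarrow> c (g u) = c (g v)" if "g \<in> ?G" for g
    using that
  proof (induction rule: generate.induct)
    case one
    then show ?case by (simp add: BijGroup_def)
  next
    case (incl s)
    then show ?case using Sp by blast
  next
    case (inv s)
    then have s: "s \<in> carrier (BijGroup \<Omega>)" using S by blast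
    have si: "s ((inv\<^bsub>BijGroup \<Omega>\<^esub> s) u) = u" "(inv\<^bsub>BijGroup \<Omega>\<^esub> s) u \<in> \<Omega>" if "u \<in> \<Omega>" for u
    proof -
      have "(inv\<^bsub>BijGroup \<Omega>\<^esub> s) u = inv_into \<Omega> s u" using s that by (simp add: carr inv_BijGroup)
      moreover have "u \<in> s ` \<Omega>" using bij[OF s] that by (simp add: bij_betw_def)
      ultimately show "s ((inv\<^bsub>BijGroup \<Omega>\<^esub> s) u) = u" "(inv\<^bsub>BijGroup \<Omega>\<^esub> s) u \<in> \<Omega>"
        by (auto simp: f_inv_into_f inv_into_into)
    qed
    show ?case
    proof (intro ballI)
      fix u v assume "u \<in> \<Omega>" "v \<in> \<Omega>"
      then show "c u = c v \<longleftrightarrow>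
          c ((inv\<^bsub>BijGroup \<Omega>\<^esub> s) u) = c ((inv\<^bsub>BijGroup \<Omega>\<^esub> s) v)"
        using Sp[OF inv si(2) si(2), of u v] si(1) by simp
    qed
  next
    case (eng g h)
    have gh: "g \<in> Bij \<Omega>" "h \<in> Bij \<Omega>" using eng Gc carr by auto
    have comp: "(g \<otimes>\<^bsub>BijGroup \<Omega>\<^esub> h) u = g (h u)" "h u \<in> \<Omega>" if "u \<in> \<Omega>" for u
      using gh that by (auto simp: BijGroup_def compose_def Bij_def dest: bij_betwE)
    show ?case
    proof (intro ballI)
      fix u v assume uv: "u \<in> \<Omega>" "v \<in> \<Omega>"
      then have "c u = c v \<longleftrightarrow> c (h u) = c (h v)" using eng.IH(2) by blast
      also have "\<dots> \<longleftrightarrow> c (g (h u)) = c (g (h v))" using eng.IH(1) comp(2) uv by blast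
      finally show "c u = c v \<longleftrightarrow>
          c ((g \<otimes>\<^bsub>BijGroup \<Omega>\<^esub> h) u) = c ((g \<otimes>\<^bsub>BijGroup \<Omega>\<^esub> h) v)"
        using comp(1) uv by simp
    qed
  qed
  have "partition_on \<Omega> ?\<Sigma>"
    by (auto simp: partition_on_def disjoint_def)
  moreover have "g ` B \<in> ?\<Sigma>" if g: "g \<in> ?G" and B: "B \<in> ?\<Sigma>" for g B
  proof -
    obtain u where u: "u \<in> \<Omega>" "B = {y \<in> \<Omega>. c y = c u}" using B by blast
    have b: "g ` \<Omega> = \<Omega>" using bij g Gc by (auto simp: bij_betw_def)
    have "g ` B = {y \<in> \<Omega>. c y = c (g u)}"
    proof (intro equalityI subsetI)
      fix z assume "z \<in> g ` B"
      then show "z \<in> {y \<in> \<Omega>. c y = c (g u)}" using u b Gp[OF g] by blast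
    next
      fix z assume z: "z \<in> {y \<in> \<Omega>. c y = c (g u)}"
      then obtain w where "w \<in> \<Omega>" "z = g w" using b by blast
      then show "z \<in> g ` B" using u z Gp[OF g] by blast
    qed
    then show ?thesis using u b by blast
  qed
  moreover have "?\<Sigma> \<noteq> (\<lambda>x. {x}) ` \<Omega>"
  proof
    assume "?\<Sigma> = (\<lambda>x. {x}) ` \<Omega>"
    then obtain z where "{y \<in> \<Omega>. c y = c x} = {z}" using xy(1) by blast
    moreover have "x \<in> {y \<in> \<Omega>. c y = c x}" "y \<in> {y \<in> \<Omega>. c y = c x}" using xy by auto
    ultimately show False using xy(3) by (metis singletonD)
  qed
  moreover have "?\<Sigma> \<noteq> {\<Omega>}"
  proof
    assume eq: "?\<Sigma> = {\<Omega>}"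
    have "c u = c v" if "u \<in> \<Omega>" "v \<in> \<Omega>" for u v
    proof -
      have "{y \<in> \<Omega>. c y = c v} \<in> {\<Omega>}" unfolding eq[symmetric] using that by blast
      then show ?thesis using that by blast
    qed
    then show False using total by (auto simp: same_value_def)
  qed
  ultimately show ?thesis unfolding block_system_def by blast
qed

definition same_block :: "'a set set \<Rightarrow> ('a \<times> 'a) set" where
  "same_block \<Sigma> = {(x, y). \<exists>B\<in>\<Sigma>. x \<in> B \<and> y \<in> B}"

lemma stable_equiv_same_block:
  assumes \<Sigma>: "block_system \<Omega> G \<Sigma>" and F: "F \<subseteq> G"
  shows "stable_equiv \<Omega> F (same_block \<Sigma>)" and "same_block \<Sigma> \<noteq> \<Omega> \<times> \<Omega>"
proof -
  let ?E = "same_block \<Sigma>"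
  have P: "partition_on \<Omega> \<Sigma>" and inv: "\<And>g B. g \<in> G \<Longrightarrow> B \<in> \<Sigma> \<Longrightarrow> g ` B \<in> \<Sigma>" and ne: "\<Sigma> \<noteq> {\<Omega>}"
    "\<Sigma> \<noteq> (\<lambda>x. {x}) ` \<Omega>"
    using \<Sigma> unfolding block_system_def by auto
  have same: "B = C" if "B \<in> \<Sigma>" "C \<in> \<Sigma>" "x \<in> B" "x \<in> C" for B C x
    using P that by (auto simp: partition_on_def disjoint_def)
  have un: "\<Union>\<Sigma> = \<Omega>" "{} \<notin> \<Sigma>" using P by (auto simp: partition_on_def)
  have "equiv \<Omega> ?E"
  proof (rule equivI)
    show "trans ?E"
    proof (rule transI)
      fix x y z assume "(x, y) \<in> ?E" "(y, z) \<in> ?E"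
      then show "(x, z) \<in> ?E" using same unfolding same_block_def by blast
    qed
  qed (use un in \<open>auto simp: refl_on_def sym_def same_block_def\<close>)
  then show "stable_equiv \<Omega> F ?E"
    using inv F unfolding stable_equiv_def same_block_def by blast
  show "?E \<noteq> \<Omega> \<times> \<Omega>"
  proof
    assume eq: "?E = \<Omega> \<times> \<Omega>"
    have "B = \<Omega>" if B: "B \<in> \<Sigma>" for B
    proof -
      obtain x where x: "x \<in> B" using B un(2) by fastforce
      then have "x \<in> \<Omega>" using B un by blast
      have "y \<in> B" if y: "y \<in> \<Omega>" for y
      proof -
        have "(x, y) \<in> ?E" using eq \<open>x \<in> \<Omega>\<close> y by blast
        then show ?thesis using x B same unfolding same_block_def by blast
      qed
      then show ?thesis using un B by blast
    qed
    then have "\<Sigma> \<subseteq> {\<Omega>}" by blast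
    moreover have "\<Sigma> \<noteq> {}" using un(1) ne(2) by auto
    ultimately show False using ne(1) by blast
  qed
qed

section \<open>From points to numbers\<close>

text \<open>Used in both directions: along \<open>e\<close> to compare the computed relation with a block system, and along
  the inverse of \<open>e\<close> to read it as a relation on \<open>\<Omega>\<close>.\<close>

lemma stable_equiv_pullback:
  assumes E: "stable_equiv B F E" and \<phi>: "\<phi> ` A \<subseteq> B"
    and F': "\<And>g. g \<in> F' \<Longrightarrow> \<exists>h\<in>F. \<forall>x\<in>A. g x \<in> A \<and> \<phi> (g x) = h (\<phi> x)"
  shows "stable_equiv A F' {(x, y). x \<in> A \<and> y \<in> A \<and> (\<phi> x, \<phi> y) \<in> E}" (is "stable_equiv _ _ ?E")
proof -
  have eq: "refl_on B E" "sym E" "trans E" using E unfolding stable_equiv_def equiv_def by auto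
  have "equiv A ?E"
  proof (rule equivI)
    show "refl_on A ?E" using eq(1) \<phi> by (auto simp: refl_on_def)
    show "sym ?E" using eq(2) by (auto simp: sym_def)
    show "trans ?E"
    proof (rule transI)
      fix x y z assume "(x, y) \<in> ?E" "(y, z) \<in> ?E"
      then show "(x, z) \<in> ?E" using eq(3) by (blast dest: transD)
    qed
  qed auto
  moreover have "(g x, g y) \<in> ?E" if g: "g \<in> F'" and xy: "(x, y) \<in> ?E" for g x y
  proof -
    obtain h where h: "h \<in> F" "\<forall>x\<in>A. g x \<in> A \<and> \<phi> (g x) = h (\<phi> x)" using F'[OF g] by blast
    have "x \<in> A" "y \<in> A" "(\<phi> x, \<phi> y) \<in> E" using xy by auto
    moreover from this have "(h (\<phi> x), h (\<phi> y)) \<in> E"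
      using E h(1) unfolding stable_equiv_def by blast
    ultimately show ?thesis using h(2) by simp
  qed
  ultimately show ?thesis unfolding stable_equiv_def by blast
qed

lemma point_number:
  assumes "bij_betw e {..<card \<Omega>} \<Omega>"
  shows "y \<in> \<Omega> \<Longrightarrow> e (point_number \<Omega> e y) = y" "y \<in> \<Omega> \<Longrightarrow> point_number \<Omega> e y < card \<Omega>"
    "x < card \<Omega> \<Longrightarrow> point_number \<Omega> e (e x) = x" "x < card \<Omega> \<Longrightarrow> e x \<in> \<Omega>"
proof -
  show "e (point_number \<Omega> e y) = y" "point_number \<Omega> e y < card \<Omega>" if "y \<in> \<Omega>"
  proof -
    have "y \<in> e ` {..<card \<Omega>}" using assms that by (simp add: bij_betw_def)
    then show "e (point_number \<Omega> e y) = y" "point_number \<Omega> e y < card \<Omega>"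
      unfolding point_number_def using f_inv_into_f[of y e "{..<card \<Omega>}"]
        inv_into_into[of y e "{..<card \<Omega>}"] by simp_all
  qed
  show "x < card \<Omega> \<Longrightarrow> point_number \<Omega> e (e x) = x"
    using assms unfolding point_number_def by (simp add: bij_betw_def inv_into_f_f)
  show "x < card \<Omega> \<Longrightarrow> e x \<in> \<Omega>" using assms by (auto dest: bij_betwE)
qed

lemma output_partition_eq:
  assumes "bij_betw e {..<card \<Omega>} \<Omega>"
  shows "output_partition \<Omega> e s =
    (\<lambda>x. {y \<in> \<Omega>. tabs s ''cell'' 0 (point_number \<Omega> e y) =
       tabs s ''cell'' 0 (point_number \<Omega> e x)}) ` \<Omega>"
proof -
  note pn = point_number[OF assms]
  have cell: "e ` {j. j < card \<Omega> \<and> tabs s ''cell'' 0 j = c} =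
      {y \<in> \<Omega>. tabs s ''cell'' 0 (point_number \<Omega> e y) = c}" for c
  proof (intro equalityI subsetI)
    fix y assume "y \<in> {y \<in> \<Omega>. tabs s ''cell'' 0 (point_number \<Omega> e y) = c}"
    then show "y \<in> e ` {j. j < card \<Omega> \<and> tabs s ''cell'' 0 j = c}"
      using pn(1,2)[of y] by (intro image_eqI[of _ _ "point_number \<Omega> e y"]) auto
  qed (use pn(3,4) in auto)
  have \<Omega>: "\<Omega> = e ` {..<card \<Omega>}" using assms by (simp add: bij_betw_def)
  have "output_partition \<Omega> e s = (\<lambda>i. {y \<in> \<Omega>. tabs s ''cell'' 0 (point_number \<Omega> e y) =
       tabs s ''cell'' 0 i}) ` {..<card \<Omega>}"
    unfolding output_partition_def cell by auto
  also have "\<dots> = (\<lambda>x. {y \<in> \<Omega>. tabs s ''cell'' 0 (point_number \<Omega> e y) =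
       tabs s ''cell'' 0 (point_number \<Omega> e x)}) ` e ` {..<card \<Omega>}"
    unfolding image_image by (rule image_cong) (simp_all add: pn(3))
  also have "e ` {..<card \<Omega>} = \<Omega>" using \<Omega> by (rule sym)
  finally show ?thesis .
qed

text \<open>All terms are dominated by \<open>n * ns * L * K\<close> because every factor is at least one; this is where
  \<open>n \<ge> 2\<close> enters, through \<open>K > 0\<close>.\<close>

lemma time_bound:
  fixes n ns L K :: nat
  assumes "n > 0" "ns > 0" "L > 0" "K > 0"
  shows "Suc L * Suc (n * (ns * (4 * K + 16) + 9) + 4 * K + 22) + n * (2 * K + 5) + 3
    \<le> 122 * (n * ns * L * K)"
proof -
  let ?N = "n * ns * K"
  have pos: "n * ns > 0" "n * K > 0" "ns * K > 0" using assms by simp_all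
  have le: "n * ns \<le> ?N" "n \<le> ?N" "K \<le> ?N" "n * K \<le> ?N" "1 \<le> ?N"
    using assms pos by simp_all
  have "Suc (n * (ns * (4 * K + 16) + 9) + 4 * K + 22) = 4 * ?N + 16 * (n * ns) + 9 * n + 4 * K + 23"
    by (simp add: algebra_simps)
  also have "\<dots> \<le> 56 * ?N" using le by linarith
  finally have "Suc L * Suc (n * (ns * (4 * K + 16) + 9) + 4 * K + 22) \<le> (2 * L) * (56 * ?N)"
    using assms(3) by (intro mult_mono) auto
  moreover have "n * (2 * K + 5) + 3 \<le> 10 * ?N"
  proof -
    have "n * (2 * K + 5) = 2 * (n * K) + 5 * n" by (simp add: algebra_simps)
    then show ?thesis using le by linarith
  qed
  moreover have "10 * ?N \<le> L * (10 * ?N)" using assms(3) by simp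
  ultimately have "Suc L * Suc (n * (ns * (4 * K + 16) + 9) + 4 * K + 22) + n * (2 * K + 5) + 3
      \<le> 2 * L * (56 * ?N) + L * (10 * ?N)" by linarith
  also have "\<dots> = 122 * (n * ns * L * K)" by (simp add: algebra_simps)
  finally show ?thesis .
qed

lemma find_blocks_correct:
  assumes fin: "finite \<Omega>" and e: "bij_betw e {..<card \<Omega>} \<Omega>"
    and S: "S \<subseteq> carrier (BijGroup \<Omega>)" "distinct ss" "set ss = S"
    and G: "G = generate (BijGroup \<Omega>) S" and L: "L > 0"
    and cert: "certified_partial_base \<Omega> G bs gs" and len: "length bs = L + 1"
    and \<Sigma>: "block_system \<Omega> G \<Sigma>"
    and short: "\<And>cs. nonredundant_base \<Sigma> (block_action G \<Sigma>) cs \<Longrightarrow> length cs \<le> L"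
  shows "\<exists>t s'. exec find_blocks (input_state \<Omega> e ss L bs gs) t s' \<and>
    block_system \<Omega> G (output_partition \<Omega> e s') \<and>
    real t \<le> 122 * (real (card \<Omega>) * real (card S) * real L * log 2 (real (card \<Omega>)))"
proof -
  let ?n = "card \<Omega>" and ?num = "point_number \<Omega> e"
  let ?K = "nat \<lfloor>log 2 (real ?n)\<rfloor>"
  let ?gens = "perm_table \<Omega> e ss" and ?base = "point_table \<Omega> e bs" and ?cert = "perm_table \<Omega> e gs"
  interpret group "BijGroup \<Omega>" by (rule group_BijGroup)
  note pn = point_number[OF e]
  have Gc: "G \<subseteq> carrier (BijGroup \<Omega>)" unfolding G by (rule generate_incl[OF S(1)])
  have one: "\<one>\<^bsub>BijGroup \<Omega>\<^esub> \<in> G" unfolding G by (rule generate.one)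
  have maps: "g x \<in> \<Omega>" if "g \<in> G" "x \<in> \<Omega>" for g x
    using Gc that by (auto simp: BijGroup_def Bij_def dest: bij_betwE)
  have SG: "S \<subseteq> G" unfolding G by (auto intro: generate.incl)
  have bs: "bs ! i \<in> \<Omega>" if "i \<le> L" for i
    using cert len that unfolding certified_partial_base_def by (auto dest!: nth_mem)
  have gs: "gs ! i \<in> G" "(gs ! i) (bs ! i) \<noteq> bs ! i" "i < length gs" if "i \<le> L" for i
    using cert len that unfolding certified_partial_base_def certifies_def by auto
  have "{bs ! 0, (gs ! 0) (bs ! 0)} \<subseteq> \<Omega>" "(gs ! 0) (bs ! 0) \<noteq> bs ! 0"
    using bs[of 0] gs[of 0] maps by auto
  then have n: "2 \<le> ?n" using card_mono[OF fin] by (metis card_2_iff)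
  \<comment> \<open>The first element of the certificate is not the identity, so the generators cannot be
    missing altogether, and the time bound is positive.\<close>
  have "S \<noteq> {}"
  proof
    assume "S = {}"
    then have "gs ! 0 = \<one>\<^bsub>BijGroup \<Omega>\<^esub>" using gs(1)[of 0] G generate_empty by simp
    then show False using gs(2)[of 0] bs[of 0] by (simp add: BijGroup_def)
  qed
  then have s: "card S > 0" using S(3) by (metis List.finite_set card_gt_0_iff)
  have len_ss: "length ss = card S" using S(2,3) distinct_card by fastforce
  have log: "1 \<le> log 2 (real ?n)" using n by simp
  have "?n < 2 powr (real (Suc ?K))"
  proof -
    have "log 2 (real ?n) < real (Suc ?K)" using log by linarith
    then show ?thesis using n by (subst (asm) log_less_iff) auto
  qed
  then have K: "?n < 2 ^ Suc ?K" by (simp add: powr_realpow del: of_nat_Suc power_Suc)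
  have gens: "?gens k x = ?num ((ss ! k) (e x))" if "k < card S" "x < ?n" for k x
    using that len_ss by (simp add: perm_table_def)
  have ssS: "ss ! k \<in> S" if "k < card S" for k using that len_ss S(3) by auto
  interpret P: pair_input ?n "card S" L ?K ?gens ?base ?cert
  proof
    show "?gens k x < ?n" if "k < card S" "x < ?n" for k x
      unfolding gens[OF that] using pn(2) maps ssS SG pn(4) that by blast
    show "?base 0 i < ?n" if "i \<le> L" for i
      using that len bs pn(2) by (simp add: point_table_def)
    show "?cert i x < ?n" if "i \<le> L" "x < ?n" for i x
      using that gs pn maps by (simp add: perm_table_def)
  qed (use n K in auto)
  have pair: "?base 0 i = ?num (bs ! i)" "?cert i (?num (bs ! i)) = ?num ((gs ! i) (bs ! i))"
    if "i \<le> L" for i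
    using that len bs gs pn by (simp_all add: point_table_def perm_table_def)
  have to_num: "\<exists>h\<in>P.moves. \<forall>x\<in>\<Omega>. g x \<in> \<Omega> \<and> ?num (g x) = h (?num x)" if g: "g \<in> S" for g
  proof -
    obtain k where k: "k < card S" "g = ss ! k" using g len_ss S(3) by (metis in_set_conv_nth)
    have "\<forall>x\<in>\<Omega>. g x \<in> \<Omega> \<and> ?num (g x) = ?gens k (?num x)"
      using maps SG g k gens pn by auto
    then show ?thesis using k unfolding P.moves_def by blast
  qed
  have from_num: "\<exists>h\<in>S. \<forall>x\<in>{..<?n}. g x \<in> {..<?n} \<and> e (g x) = h (e x)" if g: "g \<in> P.moves" for g
  proof -
    obtain k where k: "k < card S" "g = ?gens k" using g unfolding P.moves_def by auto
    have "\<forall>x\<in>{..<?n}. g x \<in> {..<?n} \<and> e (g x) = (ss ! k) (e x)"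
    proof
      fix x assume "x \<in> {..<?n}"
      then have x: "x < ?n" by simp
      then have "(ss ! k) (e x) \<in> \<Omega>" using maps ssS[OF k(1)] SG pn(4) by blast
      then show "g x \<in> {..<?n} \<and> e (g x) = (ss ! k) (e x)"
        using k gens[OF k(1) x] pn by simp
    qed
    then show ?thesis using ssS k by blast
  qed
  have "\<exists>i\<le>L. P.pair_equiv i \<noteq> P.all_pairs"
  proof -
    let ?E = "{(x, y). x \<in> {..<?n} \<and> y \<in> {..<?n} \<and> (e x, e y) \<in> same_block \<Sigma>}"
    obtain i B where i: "i \<le> L" "B \<in> \<Sigma>" "bs ! i \<in> B" "(gs ! i) (bs ! i) \<in> B"
      using exists_certificate_in_block[OF fin one \<Sigma> short cert len] by blast
    have "stable_equiv {..<?n} P.moves ?E"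
    proof (rule stable_equiv_pullback[where \<phi> = e, OF stable_equiv_same_block(1)[OF \<Sigma> SG]])
      show "e ` {..<?n} \<subseteq> \<Omega>" using pn(4) by auto
    qed (rule from_num)
    moreover have "(?base 0 i, ?cert i (?base 0 i)) \<in> ?E"
    proof -
      have a: "bs ! i \<in> \<Omega>" and b: "(gs ! i) (bs ! i) \<in> \<Omega>"
        using bs[OF i(1)] maps[OF gs(1)[OF i(1)]] by blast+
      have "(bs ! i, (gs ! i) (bs ! i)) \<in> same_block \<Sigma>"
        using i unfolding same_block_def by blast
      then show ?thesis unfolding pair[OF i(1)] using pn(1,2)[OF a] pn(1,2)[OF b] by simp
    qed
    ultimately have "P.pair_equiv i \<subseteq> ?E" unfolding P.pair_equiv_def by (rule generated_equiv_least)
    moreover have "?E \<noteq> P.all_pairs"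
    proof
      assume eq: "?E = P.all_pairs"
      have "(x, y) \<in> same_block \<Sigma>" if "x \<in> \<Omega>" "y \<in> \<Omega>" for x y
      proof -
        have "(?num x, ?num y) \<in> ?E" unfolding eq using pn(2) that by simp
        then show ?thesis using pn(1) that by simp
      qed
      moreover have "same_block \<Sigma> \<subseteq> \<Omega> \<times> \<Omega>"
        using stable_equiv_same_block(1)[OF \<Sigma> SG] unfolding stable_equiv_def equiv_def by blast
      ultimately have "same_block \<Sigma> = \<Omega> \<times> \<Omega>" by auto
      then show False using stable_equiv_same_block(2)[OF \<Sigma> SG] by blast
    qed
    ultimately show ?thesis using i(1) by blast
  qed
  then have "runs find_blocks (input_state \<Omega> e ss L bs gs)
      (Suc L * Suc P.attempt_time + ?n * (2 * ?K + 5) + 3)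
      (\<lambda>s'. \<exists>i\<le>L. P.pair_equiv i \<noteq> P.all_pairs \<and> same_value {..<?n} (tabs s' ''cell'' 0) = P.pair_equiv i)"
    by (intro P.runs_find_blocks) (auto simp: input_state_def P.loaded_def len_ss)
  then obtain t s' i where t: "exec find_blocks (input_state \<Omega> e ss L bs gs) t s'"
      "t \<le> Suc L * Suc P.attempt_time + ?n * (2 * ?K + 5) + 3"
    and i: "i \<le> L" "P.pair_equiv i \<noteq> P.all_pairs" "same_value {..<?n} (tabs s' ''cell'' 0) = P.pair_equiv i"
    unfolding runs_def by blast
  let ?c = "\<lambda>x. tabs s' ''cell'' 0 (?num x)"
  have same: "same_value \<Omega> ?c = {(x, y). x \<in> \<Omega> \<and> y \<in> \<Omega> \<and> (?num x, ?num y) \<in> P.pair_equiv i}"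
    unfolding i(3)[symmetric] using pn(2) by (auto simp: same_value_def)
  have "block_system \<Omega> G (output_partition \<Omega> e s')"
    unfolding output_partition_eq[OF e] G
  proof (rule block_system_level_sets[OF fin S(1), where x = "bs ! i" and y = "(gs ! i) (bs ! i)"])
    show "stable_equiv \<Omega> S (same_value \<Omega> ?c)"
      unfolding same
    proof (rule stable_equiv_pullback[where \<phi> = ?num, OF P.pair_equiv_props(1)[OF i(1)]])
      show "?num ` \<Omega> \<subseteq> {..<?n}" using pn(2) by auto
    qed (rule to_num)
    show "same_value \<Omega> ?c \<noteq> \<Omega> \<times> \<Omega>"
    proof
      assume eq: "same_value \<Omega> ?c = \<Omega> \<times> \<Omega>"
      have "tabs s' ''cell'' 0 x = tabs s' ''cell'' 0 y" if "x < ?n" "y < ?n" for x y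
      proof -
        have "(e x, e y) \<in> same_value \<Omega> ?c" unfolding eq using pn(4) that by blast
        then show ?thesis using pn(3) that by simp
      qed
      then have "same_value {..<?n} (tabs s' ''cell'' 0) = P.all_pairs" by (auto simp: same_value_def)
      then show False using i(2,3) by simp
    qed
    have "(?base 0 i, ?cert i (?base 0 i)) \<in> same_value {..<?n} (tabs s' ''cell'' 0)"
      unfolding i(3) by (rule P.pair_equiv_props(2)[OF i(1)])
    then show "?c (bs ! i) = ?c ((gs ! i) (bs ! i))" unfolding pair[OF i(1)] by simp
    show "bs ! i \<in> \<Omega>" "(gs ! i) (bs ! i) \<in> \<Omega>"
      using bs[OF i(1)] maps[OF gs(1)[OF i(1)]] by blast+
    show "bs ! i \<noteq> (gs ! i) (bs ! i)" using gs(2)[OF i(1)] by (rule not_sym)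
  qed
  moreover have "real t \<le> 122 * (real ?n * real (card S) * real L * log 2 (real ?n))"
  proof -
    have "?K > 0" using log by linarith
    then have "t \<le> 122 * (?n * card S * L * ?K)"
      using t(2) time_bound[of ?n "card S" L ?K] n s L unfolding P.attempt_time_def by linarith
    then have "real t \<le> real (122 * (?n * card S * L * ?K))" by (rule of_nat_mono)
    also have "\<dots> = 122 * (real ?n * real (card S) * real L) * real ?K" by simp
    also have "\<dots> \<le> 122 * (real ?n * real (card S) * real L) * log 2 (real ?n)"
      using log by (intro mult_left_mono) auto
    finally show ?thesis by (simp add: mult.assoc)
  qed
  ultimately show ?thesis using t(1) by blast
qed

section \<open>Finding a block system\<close>

theorem mainTheorem4:
  shows "\<exists>(P :: prog) (C :: real).
    \<forall>(\<Omega> :: 'a set) (e :: nat \<Rightarrow> 'a) (S :: ('a \<Rightarrow> 'a) set) (ss :: ('a \<Rightarrow> 'a) list)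
      (G :: ('a \<Rightarrow> 'a) set) (L :: nat) (bs :: 'a list) (gs :: ('a \<Rightarrow> 'a) list).
      finite \<Omega> \<and> bij_betw e {..<card \<Omega>} \<Omega> \<and>
      S \<subseteq> carrier (BijGroup \<Omega>) \<and> distinct ss \<and> set ss = S \<and>
      G = generate (BijGroup \<Omega>) S \<and> transitive_on \<Omega> G \<and>
      L > 0 \<and>
      certified_partial_base \<Omega> G bs gs \<and> length bs = L + 1 \<and>
      (\<exists>\<Sigma>. block_system \<Omega> G \<Sigma> \<and>
           (\<forall>cs. nonredundant_base \<Sigma> (block_action G \<Sigma>) cs \<longrightarrow> length cs \<le> L))
      \<longrightarrow>
      (\<exists>t s'. exec P (input_state \<Omega> e ss L bs gs) t s' \<and>
              block_system \<Omega> G (output_partition \<Omega> e s') \<and>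
              real t \<le> C * (real (card \<Omega>) * real (card S) * real L * log 2 (real (card \<Omega>))))"
  by (intro exI[of _ find_blocks] exI[of _ "122::real"] allI impI, elim conjE exE,
      rule find_blocks_correct) blast+

end
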